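(* Let $\Gamma$ be a discrete group and let $\mathcal{E}=(E_k)_{k\in\mathbb{N}}$ be a uniformly convex asymptotic Banach $\Gamma$-module. Then $H^1_a(\Gamma;\mathcal{E})=0$.
   Context: $\mathbb{N}$ is the set of positive integers, and $\mathcal{U}$ is a fixed non-principal ultrafilter on $\mathbb{N}$; limits along $\mathcal{U}$ are taken in the variable $k$. Ultraproducts: for a sequence $(V_k)_{k\in\mathbb{N}}$ of Banach spaces, $\prod_{\mathcal{U}}V_k$ is the Banach space obtained as the quotient of the space of sequences $(x_k)\in\prod_k V_k$ with $\sup_k\|x_k\|<\infty$ by the subspace of those with $\lim_{\mathcal{U}}\|x_k\|=0$, with norm $\|[x_k]\|_{\mathcal{U}}=\lim_{\mathcal{U}}\|x_k\|$. A sequence of bounded linear maps $f_k:V_k\to W_k$ with $\sup_k\|f_k\|<\infty$ induces a bounded linear map $f_{\mathcal{U}}:\prod_{\mathcal{U}}V_k\to\prod_{\mathcal{U}}W_k$, $[x_k]\mapsto[f_k(x_k)]$. An asymptotic Banach $\Gamma$-module is a sequence $\mathcal{E}=(E_k)_{k\in\mathbb{N}}$ of Banach spaces together with group morphisms $\pi_k:\Gamma\to\mathrm{Isom}(E_k)$ into the groups of linear isometries of $E_k$; write $\gamma\cdot x=\pi_k(\gamma)x$. It is uniformly convex if there is a continuous non-decreasing function $\delta:(0,2]\to(0,1]$ such that for all $k$, all $\varepsilon\in(0,2]$ and all $u_1,u_2\in E_k$ with $\|u_1\|,\|u_2\|\le1$: if $\|u_1-u_2\|\ge\varepsilon$ then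 $\left\|\frac{u_1+u_2}{2}\right\|\le1-\delta(\varepsilon)$. For $n\ge 0$ let $\ell^\infty(\Gamma^n,E_k)$ be the Banach space of bounded maps $\Gamma^n\to E_k$ with the supremum norm (so it is $E_k$ for $n=0$). For $n\geq 1$ the codifferential $d^n_k:\ell^\infty(\Gamma^{n-1},E_k)\to\ell^\infty(\Gamma^{n},E_k)$ is $$d^n_kf(\gamma_1,\dots,\gamma_n)=\gamma_1\cdot f(\gamma_2,\dots,\gamma_n)+\sum_{i=1}^{n-1}(-1)^if(\gamma_1,\dots,\gamma_i\gamma_{i+1},\dots,\gamma_n)+(-1)^nf(\gamma_1,\dots,\gamma_{n-1}).$$ Let $C^n_a(\Gamma;\mathcal{E})=\prod_{\mathcal{U}}\ell^\infty(\Gamma^n,E_k)$ and let $d^n_{\mathcal{U}}:C^{n-1}_a(\Gamma;\mathcal{E})\to C^n_a(\Gamma;\mathcal{E})$ be the map induced by $(d^n_k)_k$. The asymptotic cohomology is $H^n_a(\Gamma;\mathcal{E})=\ker d^{n+1}_{\mathcal{U}}/\operatorname{im}d^n_{\mathcal{U}}$. *)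

theory Defs
  imports "HOL-Analysis.Analysis" "HOL-Algebra.Module" "HOL-Algebra.AbelCoset" "HOL-Algebra.Bij"
begin

section \<open>Banach spaces with a carrier set\<close>

text \<open>
  The spaces of a sequence \<open>E 0, E 1, \<dots>\<close> are unrelated, so they cannot be described by a type
  class. They are records over one element type, each with its own carrier, operations and norm.
  The scalar type ranges over class \<open>real_normed_field\<close>, which contains \<open>real\<close> and \<open>complex\<close>.
  The fields \<open>mult\<close> and \<open>one\<close>, which the record of modules inherits from rings, are unused.
\<close>

record ('k, 'a) normed_module = "('k, 'a) module" +
  vnorm :: "'a \<Rightarrow> real"

definition scalars :: "'k::real_normed_field ring" where
  "scalars = \<lparr>carrier = UNIV, mult = (*), one = 1, zero = 0, add = (+)\<rparr>"

locale banach_space =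
  fixes V :: "('k::real_normed_field, 'a) normed_module" (structure)
  assumes vector_space: "module scalars V"
    and vnorm_nonneg: "x \<in> carrier V \<Longrightarrow> 0 \<le> vnorm V x"
    and vnorm_eq_0_iff: "x \<in> carrier V \<Longrightarrow> vnorm V x = 0 \<longleftrightarrow> x = \<zero>"
    and vnorm_triangle:
      "x \<in> carrier V \<Longrightarrow> y \<in> carrier V \<Longrightarrow> vnorm V (x \<oplus> y) \<le> vnorm V x + vnorm V y"
    and vnorm_smult: "x \<in> carrier V \<Longrightarrow> vnorm V (c \<odot> x) = norm c * vnorm V x"
    and complete:
      "(\<And>n. X n \<in> carrier V) \<Longrightarrow>
       (\<And>e. 0 < e \<Longrightarrow> \<exists>N. \<forall>m\<ge>N. \<forall>n\<ge>N. vnorm V (X m \<ominus> X n) < e) \<Longrightarrow>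
       \<exists>l\<in>carrier V. (\<lambda>n. vnorm V (X n \<ominus> l)) \<longlonglongrightarrow> 0"

definition linear_isometries :: "('k, 'a) normed_module \<Rightarrow> ('a \<Rightarrow> 'a) set" where
  "linear_isometries V =
    {f \<in> Bij (carrier V).
      (\<forall>x\<in>carrier V. \<forall>y\<in>carrier V. f (x \<oplus>\<^bsub>V\<^esub> y) = f x \<oplus>\<^bsub>V\<^esub> f y) \<and>
      (\<forall>c. \<forall>x\<in>carrier V. f (c \<odot>\<^bsub>V\<^esub> x) = c \<odot>\<^bsub>V\<^esub> f x) \<and>
      (\<forall>x\<in>carrier V. vnorm V (f x) = vnorm V x)}"

definition Isom :: "('k, 'a) normed_module \<Rightarrow> ('a \<Rightarrow> 'a) monoid" where
  "Isom V = (BijGroup (carrier V))\<lparr>carrier := linear_isometries V\<rparr>"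

text \<open>
  The quotient of \<open>V\<close> by a subspace \<open>W\<close>, whose elements are the cosets of \<open>W\<close>. The union in
  \<open>smult\<close> is over sets that all coincide.
\<close>

definition quotient_space :: "('k, 'a, 'm) module_scheme \<Rightarrow> 'a set \<Rightarrow> ('k, 'a set) module" where
  "quotient_space V W =
    \<lparr>carrier = a_rcosets\<^bsub>V\<^esub> W,
     mult = undefined,
     one = undefined,
     zero = W,
     add = (<+>\<^bsub>V\<^esub>),
     smult = \<lambda>c A. \<Union>x\<in>A. W +>\<^bsub>V\<^esub> (c \<odot>\<^bsub>V\<^esub> x)\<rparr>"


section \<open>Ultraproducts\<close>

definition nonprincipal_ultrafilter :: "nat filter \<Rightarrow> bool" where
  "nonprincipal_ultrafilter \<U> \<longleftrightarrow>
    \<U> \<noteq> bot \<and>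
    (\<forall>P. eventually P \<U> \<or> eventually (\<lambda>k. \<not> P k) \<U>) \<and>
    (\<forall>n. \<U> \<noteq> principal {n})"

definition bounded_sequences ::
    "(nat \<Rightarrow> ('k, 'a) normed_module) \<Rightarrow> ('k, nat \<Rightarrow> 'a) module" where
  "bounded_sequences V =
    \<lparr>carrier = {x. (\<forall>k. x k \<in> carrier (V k)) \<and> bdd_above (range (\<lambda>k. vnorm (V k) (x k)))},
     mult = undefined,
     one = undefined,
     zero = \<lambda>k. \<zero>\<^bsub>V k\<^esub>,
     add = \<lambda>x y k. x k \<oplus>\<^bsub>V k\<^esub> y k,
     smult = \<lambda>c x k. c \<odot>\<^bsub>V k\<^esub> x k\<rparr>"

definition null_sequences ::
    "nat filter \<Rightarrow> (nat \<Rightarrow> ('k, 'a) normed_module) \<Rightarrow> (nat \<Rightarrow> 'a) set" where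
  "null_sequences \<U> V =
    {x \<in> carrier (bounded_sequences V). ((\<lambda>k. vnorm (V k) (x k)) \<longlongrightarrow> 0) \<U>}"

definition ultraclass ::
    "nat filter \<Rightarrow> (nat \<Rightarrow> ('k, 'a) normed_module) \<Rightarrow> (nat \<Rightarrow> 'a) \<Rightarrow> (nat \<Rightarrow> 'a) set" where
  "ultraclass \<U> V x = null_sequences \<U> V +>\<^bsub>bounded_sequences V\<^esub> x"

definition ultraproduct ::
    "nat filter \<Rightarrow> (nat \<Rightarrow> ('k, 'a) normed_module) \<Rightarrow> ('k, (nat \<Rightarrow> 'a) set) normed_module" where
  "ultraproduct \<U> V =
    module.extend (quotient_space (bounded_sequences V) (null_sequences \<U> V))
      \<lparr>vnorm = \<lambda>A. THE r. \<forall>x\<in>A. ((\<lambda>k. vnorm (V k) (x k)) \<longlongrightarrow> r) \<U>\<rparr>"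

text \<open>
  The map of ultraproducts induced by maps \<open>f k : V k \<rightarrow> W k\<close>, where \<open>W\<close> is the sequence of
  target spaces. For uniformly bounded linear maps \<open>f k\<close> the classes in the union all coincide.
\<close>

definition ultramap ::
    "nat filter \<Rightarrow> (nat \<Rightarrow> ('k, 'b) normed_module) \<Rightarrow> (nat \<Rightarrow> 'a \<Rightarrow> 'b) \<Rightarrow>
      (nat \<Rightarrow> 'a) set \<Rightarrow> (nat \<Rightarrow> 'b) set" where
  "ultramap \<U> W f A = (\<Union>x\<in>A. ultraclass \<U> W (\<lambda>k. f k (x k)))"


section \<open>Asymptotic Banach modules\<close>

locale asymptotic_banach_module =
  fixes \<Gamma> :: "('g, 'm) monoid_scheme"
    and E :: "nat \<Rightarrow> ('k::real_normed_field, 'a) normed_module"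
    and \<pi> :: "nat \<Rightarrow> 'g \<Rightarrow> 'a \<Rightarrow> 'a"
  assumes banach: "banach_space (E k)"
    and action: "\<pi> k \<in> hom \<Gamma> (Isom (E k))"

definition uniformly_convex :: "(nat \<Rightarrow> ('k::real_normed_field, 'a) normed_module) \<Rightarrow> bool" where
  "uniformly_convex E \<longleftrightarrow>
    (\<exists>\<delta>::real \<Rightarrow> real.
      \<delta> \<in> {0<..2} \<rightarrow> {0<..1} \<and> continuous_on {0<..2} \<delta> \<and> mono_on {0<..2} \<delta> \<and>
      (\<forall>k. \<forall>\<epsilon>\<in>{0<..2}. \<forall>u\<in>carrier (E k). \<forall>v\<in>carrier (E k).
        vnorm (E k) u \<le> 1 \<longrightarrow> vnorm (E k) v \<le> 1 \<longrightarrow> vnorm (E k) (u \<ominus>\<^bsub>E k\<^esub> v) \<ge> \<epsilon> \<longrightarrow>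
        vnorm (E k) ((1/2) \<odot>\<^bsub>E k\<^esub> (u \<oplus>\<^bsub>E k\<^esub> v)) \<le> 1 - \<delta> \<epsilon>))"


section \<open>Asymptotic cohomology\<close>

definition tuples :: "('g, 'm) monoid_scheme \<Rightarrow> nat \<Rightarrow> 'g list set" where
  "tuples \<Gamma> n = {gs. length gs = n \<and> set gs \<subseteq> carrier \<Gamma>}"

text \<open>Bounded maps from a nonempty set \<open>S\<close> to \<open>V\<close>, extended by \<open>undefined\<close> outside \<open>S\<close>.\<close>

definition ell_infty :: "'s set \<Rightarrow> ('k, 'a) normed_module \<Rightarrow> ('k, 's \<Rightarrow> 'a) normed_module" where
  "ell_infty S V =
    \<lparr>carrier = {f \<in> S \<rightarrow>\<^sub>E carrier V. bdd_above ((\<lambda>s. vnorm V (f s)) ` S)},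
     mult = undefined,
     one = undefined,
     zero = \<lambda>s\<in>S. \<zero>\<^bsub>V\<^esub>,
     add = \<lambda>f g. \<lambda>s\<in>S. f s \<oplus>\<^bsub>V\<^esub> g s,
     smult = \<lambda>c f. \<lambda>s\<in>S. c \<odot>\<^bsub>V\<^esub> f s,
     vnorm = \<lambda>f. SUP s\<in>S. vnorm V (f s)\<rparr>"

text \<open>
  For \<open>n \<ge> 1\<close>, the map from \<open>ell_infty (tuples \<Gamma> (n - 1)) V\<close> to \<open>ell_infty (tuples \<Gamma> n) V\<close>.
  List positions count from 0: for \<open>gs = [\<gamma>\<^sub>1, \<dots>, \<gamma>\<^sub>n]\<close> the entry \<open>gs ! (i - 1)\<close> is \<open>\<gamma>\<^sub>i\<close>, and
  the \<open>i\<close>-th summand is evaluated at \<open>[\<gamma>\<^sub>1, \<dots>, \<gamma>\<^sub>i\<gamma>\<^sub>i\<^sub>+\<^sub>1, \<dots>, \<gamma>\<^sub>n]\<close>.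
\<close>

definition codifferential ::
    "('g, 'm) monoid_scheme \<Rightarrow> ('k::real_normed_field, 'a) normed_module \<Rightarrow> ('g \<Rightarrow> 'a \<Rightarrow> 'a) \<Rightarrow>
      nat \<Rightarrow> ('g list \<Rightarrow> 'a) \<Rightarrow> ('g list \<Rightarrow> 'a)" where
  "codifferential \<Gamma> V \<rho> n f =
    (\<lambda>gs\<in>tuples \<Gamma> n.
      \<rho> (hd gs) (f (tl gs))
      \<oplus>\<^bsub>V\<^esub> (\<Oplus>\<^bsub>V\<^esub>i\<in>{1..<n}.
            (- 1) ^ i \<odot>\<^bsub>V\<^esub> f (take (i - 1) gs @ [gs ! (i - 1) \<otimes>\<^bsub>\<Gamma>\<^esub> gs ! i] @ drop (i + 1) gs))
      \<oplus>\<^bsub>V\<^esub> (- 1) ^ n \<odot>\<^bsub>V\<^esub> f (butlast gs))"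

definition asymptotic_cochains ::
    "nat filter \<Rightarrow> ('g, 'm) monoid_scheme \<Rightarrow> (nat \<Rightarrow> ('k, 'a) normed_module) \<Rightarrow> nat \<Rightarrow>
      ('k, (nat \<Rightarrow> 'g list \<Rightarrow> 'a) set) normed_module" where
  "asymptotic_cochains \<U> \<Gamma> E n = ultraproduct \<U> (\<lambda>k. ell_infty (tuples \<Gamma> n) (E k))"

definition asymptotic_codifferential ::
    "nat filter \<Rightarrow> ('g, 'm) monoid_scheme \<Rightarrow> (nat \<Rightarrow> ('k::real_normed_field, 'a) normed_module) \<Rightarrow>
      (nat \<Rightarrow> 'g \<Rightarrow> 'a \<Rightarrow> 'a) \<Rightarrow> nat \<Rightarrow>
      (nat \<Rightarrow> 'g list \<Rightarrow> 'a) set \<Rightarrow> (nat \<Rightarrow> 'g list \<Rightarrow> 'a) set" where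
  "asymptotic_codifferential \<U> \<Gamma> E \<pi> n =
    ultramap \<U> (\<lambda>k. ell_infty (tuples \<Gamma> n) (E k)) (\<lambda>k. codifferential \<Gamma> (E k) (\<pi> k) n)"

definition asymptotic_cocycles where
  "asymptotic_cocycles \<U> \<Gamma> E \<pi> n =
    a_kernel (asymptotic_cochains \<U> \<Gamma> E n) (asymptotic_cochains \<U> \<Gamma> E (n + 1))
      (asymptotic_codifferential \<U> \<Gamma> E \<pi> (n + 1))"

text \<open>The codifferential into degree 0 is the zero map.\<close>

definition asymptotic_coboundaries where
  "asymptotic_coboundaries \<U> \<Gamma> E \<pi> n =
    (if n = 0 then {\<zero>\<^bsub>asymptotic_cochains \<U> \<Gamma> E 0\<^esub>}
     else asymptotic_codifferential \<U> \<Gamma> E \<pi> n ` carrier (asymptotic_cochains \<U> \<Gamma> E (n - 1)))"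

definition asymptotic_cohomology ::
    "nat filter \<Rightarrow> ('g, 'm) monoid_scheme \<Rightarrow> (nat \<Rightarrow> ('k::real_normed_field, 'a) normed_module) \<Rightarrow>
      (nat \<Rightarrow> 'g \<Rightarrow> 'a \<Rightarrow> 'a) \<Rightarrow> nat \<Rightarrow> ('k, (nat \<Rightarrow> 'g list \<Rightarrow> 'a) set set) module" where
  "asymptotic_cohomology \<U> \<Gamma> E \<pi> n =
    quotient_space
      ((asymptotic_cochains \<U> \<Gamma> E n)\<lparr>carrier := asymptotic_cocycles \<U> \<Gamma> E \<pi> n\<rparr>)
      (asymptotic_coboundaries \<U> \<Gamma> E \<pi> n)"

end

theory Submission
  imports Defs
begin

text \<open>
  A degree 1 asymptotic cocycle is given by bounded maps \<open>c\<^sub>k : \<Gamma> \<rightarrow> E\<^sub>k\<close> such that the affine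
  isometries \<open>x \<mapsto> \<gamma> \<cdot> x + c\<^sub>k \<gamma>\<close> form an action up to an error \<open>\<epsilon>\<^sub>k\<close> that tends to 0 along \<open>\<U>\<close>.
  They almost preserve the bounded set \<open>c\<^sub>k \<Gamma>\<close>, hence by uniform convexity almost fix any point \<open>v\<^sub>k\<close>
  that is a Chebyshev centre of this set up to \<open>1 / (k + 1)\<close>. So \<open>c\<^sub>k\<close> is close to the coboundary of
  \<open>- v\<^sub>k\<close>, uniformly on \<open>\<Gamma>\<close>.
\<close>

text \<open>The value \<open>c g\<close> is the image of 0 under the affine isometry of
  \<open>g\<close>, so in the exact case the set of values is the orbit of 0, and the argument is
  the one by which a bounded orbit yields a fixed point. The error \<open>\<epsilon> k\<close> of
  the action remains whatever centre is taken, so a centre that is optimal only up to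
  \<open>1 / (k + 1)\<close> serves as well as an exact one. Both errors vanish along
  \<open>\<U>\<close>, the second because \<open>\<U>\<close> is non-principal. The obstacle is
  uniformity: the radius \<open>r\<close> of the set depends on \<open>k\<close>, and two centres at
  distance at least \<open>t\<close> give a gain of
  \<open>(r + \<epsilon>) * \<delta> (t / (r + \<epsilon>))\<close>. If \<open>C\<close> bounds all
  values for all \<open>k\<close>, then \<open>t / 2 \<le> r + \<epsilon> < C + 1\<close>, and by
  monotonicity of \<open>\<delta>\<close> the gain is at least
  \<open>t / 2 * \<delta> (t / (C + 1))\<close>. This number depends neither on \<open>k\<close> nor
  on \<open>g\<close>. Once the two errors add up to at most this number and at most 1, every
  \<open>g\<close> moves the centre by less than \<open>t\<close>.\<close>

section \<open>Normed abelian groups\<close>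

text \<open>The structure shared by \<open>E k\<close> and \<open>ell_infty S (E k)\<close>. That a
  quotient consists of one coset is a statement about addition, and the norm decides which sequences
  are null; ultraproducts and their induced maps are developed on this basis.\<close>

locale normed_group = abelian_group V
  for V :: "('k, 'a) normed_module" (structure) +
  assumes norm_nonneg: "x \<in> carrier V \<Longrightarrow> 0 \<le> vnorm V x"
    and norm_zero: "vnorm V \<zero> = 0"
    and norm_triangle:
      "x \<in> carrier V \<Longrightarrow> y \<in> carrier V \<Longrightarrow> vnorm V (x \<oplus> y) \<le> vnorm V x + vnorm V y"
    and norm_minus: "x \<in> carrier V \<Longrightarrow> vnorm V (\<ominus> x) = vnorm V x"
begin

lemma norm_triangle_minus:
  assumes "x \<in> carrier V" "y \<in> carrier V"
  shows "vnorm V (x \<ominus> y) \<le> vnorm V x + vnorm V y"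
  using norm_triangle[of x "\<ominus> y"] assms by (simp add: a_minus_def norm_minus)

lemma norm_finsum:
  assumes "h \<in> A \<rightarrow> carrier V"
  shows "vnorm V (\<Oplus>i\<in>A. h i) \<le> (\<Sum>i\<in>A. vnorm V (h i))"
  using assms
proof (induction A rule: infinite_finite_induct)
  case (insert i A)
  then have "vnorm V (h i \<oplus> (\<Oplus>i\<in>A. h i)) \<le> vnorm V (h i) + vnorm V (\<Oplus>i\<in>A. h i)"
    by (intro norm_triangle finsum_closed) auto
  with insert show ?case by (simp add: Pi_iff)
qed (simp_all add: norm_zero finsum_infinite)

end

section \<open>Banach spaces as normed groups\<close>

context banach_space
begin

sublocale module scalars V
  by (rule vector_space)

lemma smult_closed' [simp]: "x \<in> carrier V \<Longrightarrow> c \<odot> x \<in> carrier V"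
  by (rule smult_closed) (simp_all add: scalars_def)

lemma smult_add: "x \<in> carrier V \<Longrightarrow> y \<in> carrier V \<Longrightarrow> c \<odot> (x \<oplus> y) = c \<odot> x \<oplus> c \<odot> y"
  by (rule smult_r_distr) (simp_all add: scalars_def)

lemma add_smult: "x \<in> carrier V \<Longrightarrow> (b + c) \<odot> x = b \<odot> x \<oplus> c \<odot> x"
  using smult_l_distr[of b c x] by (simp add: scalars_def)

lemma smult_smult: "x \<in> carrier V \<Longrightarrow> b \<odot> (c \<odot> x) = (b * c) \<odot> x"
  using smult_assoc1[of b c x] by (simp add: scalars_def)

lemma one_smult [simp]: "x \<in> carrier V \<Longrightarrow> 1 \<odot> x = x"
  using smult_one[of x] by (simp add: scalars_def)

lemma zero_smult: "x \<in> carrier V \<Longrightarrow> 0 \<odot> x = \<zero>"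
  using vnorm_eq_0_iff[of "0 \<odot> x"] by (simp add: vnorm_smult)

lemma minus_one_smult: "x \<in> carrier V \<Longrightarrow> (- 1) \<odot> x = \<ominus> x"
  using add_smult[of x "-1" 1] by (intro minus_equality[symmetric]) (simp_all add: zero_smult)

lemma smult_diff:
  assumes "x \<in> carrier V" "y \<in> carrier V"
  shows "c \<odot> (x \<ominus> y) = c \<odot> x \<ominus> c \<odot> y"
  using assms
  by (simp add: a_minus_def smult_add minus_one_smult[symmetric] smult_smult)

sublocale normed_group V
proof
  show "vnorm V (\<ominus> x) = vnorm V x" if "x \<in> carrier V" for x
    using that vnorm_smult[of x "-1"] by (simp add: minus_one_smult)
qed (simp_all add: vnorm_nonneg vnorm_eq_0_iff vnorm_triangle)

end

section \<open>Bounded functions with the supremum norm\<close>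

lemma carrier_ell_infty_iff:
  "f \<in> carrier (ell_infty S V) \<longleftrightarrow>
    f \<in> S \<rightarrow>\<^sub>E carrier V \<and> bdd_above ((\<lambda>s. vnorm V (f s)) ` S)"
  by (simp add: ell_infty_def)

lemma ell_inftyI:
  assumes "f \<in> S \<rightarrow>\<^sub>E carrier V" "\<And>s. s \<in> S \<Longrightarrow> vnorm V (f s) \<le> b"
  shows "f \<in> carrier (ell_infty S V)"
  using assms by (auto simp: carrier_ell_infty_iff intro!: bdd_aboveI2)

lemma ell_infty_apply_closed:
  "f \<in> carrier (ell_infty S V) \<Longrightarrow> s \<in> S \<Longrightarrow> f s \<in> carrier V"
  by (auto simp: ell_infty_def)

lemma norm_le_vnorm_ell_infty:
  assumes "f \<in> carrier (ell_infty S V)" "s \<in> S"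
  shows "vnorm V (f s) \<le> vnorm (ell_infty S V) f"
  using assms by (auto simp: ell_infty_def intro: cSUP_upper)

lemma vnorm_ell_infty_le:
  assumes "S \<noteq> {}" "\<And>s. s \<in> S \<Longrightarrow> vnorm V (f s) \<le> b"
  shows "vnorm (ell_infty S V) f \<le> b"
  using assms by (auto simp: ell_infty_def intro: cSUP_least)

lemma add_ell_infty: "f \<oplus>\<^bsub>ell_infty S V\<^esub> g = (\<lambda>s\<in>S. f s \<oplus>\<^bsub>V\<^esub> g s)"
  by (simp add: ell_infty_def)

lemma zero_ell_infty: "\<zero>\<^bsub>ell_infty S V\<^esub> = (\<lambda>s\<in>S. \<zero>\<^bsub>V\<^esub>)"
  by (simp add: ell_infty_def)

context normed_group
begin

lemma ell_infty_add_closed: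
  assumes "f \<in> carrier (ell_infty S V)" "g \<in> carrier (ell_infty S V)"
  shows "f \<oplus>\<^bsub>ell_infty S V\<^esub> g \<in> carrier (ell_infty S V)"
proof (rule ell_inftyI)
  show "f \<oplus>\<^bsub>ell_infty S V\<^esub> g \<in> S \<rightarrow>\<^sub>E carrier V"
    using assms by (auto simp: add_ell_infty ell_infty_apply_closed)
  show "vnorm V ((f \<oplus>\<^bsub>ell_infty S V\<^esub> g) s)
      \<le> vnorm (ell_infty S V) f + vnorm (ell_infty S V) g" if "s \<in> S" for s
    using that norm_triangle[of "f s" "g s"] assms
      norm_le_vnorm_ell_infty[OF assms(1) that] norm_le_vnorm_ell_infty[OF assms(2) that]
    by (simp add: add_ell_infty ell_infty_apply_closed)
qed

lemma ell_infty_uminus_closed: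
  assumes "f \<in> carrier (ell_infty S V)"
  shows "(\<lambda>s\<in>S. \<ominus> f s) \<in> carrier (ell_infty S V)"
proof (rule ell_inftyI)
  show "vnorm V ((\<lambda>s\<in>S. \<ominus> f s) s) \<le> vnorm (ell_infty S V) f" if "s \<in> S" for s
    using that assms norm_le_vnorm_ell_infty[OF assms that]
    by (simp add: ell_infty_apply_closed norm_minus)
qed (use assms in \<open>auto simp: ell_infty_apply_closed\<close>)

lemma ell_infty_uminus_add:
  assumes "f \<in> carrier (ell_infty S V)"
  shows "(\<lambda>s\<in>S. \<ominus> f s) \<oplus>\<^bsub>ell_infty S V\<^esub> f = \<zero>\<^bsub>ell_infty S V\<^esub>"
  using assms
  by (auto simp: add_ell_infty zero_ell_infty fun_eq_iff ell_infty_apply_closed l_neg)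

lemma abelian_group_ell_infty: "abelian_group (ell_infty S V)"
proof (rule abelian_groupI)
  fix f g h
  assume f: "f \<in> carrier (ell_infty S V)" and g: "g \<in> carrier (ell_infty S V)"
  show "f \<oplus>\<^bsub>ell_infty S V\<^esub> g \<in> carrier (ell_infty S V)"
    using f g by (rule ell_infty_add_closed)
  show "f \<oplus>\<^bsub>ell_infty S V\<^esub> g = g \<oplus>\<^bsub>ell_infty S V\<^esub> f"
    using f g by (auto simp: add_ell_infty fun_eq_iff ell_infty_apply_closed a_comm)
  show "f \<oplus>\<^bsub>ell_infty S V\<^esub> g \<oplus>\<^bsub>ell_infty S V\<^esub> h
      = f \<oplus>\<^bsub>ell_infty S V\<^esub> (g \<oplus>\<^bsub>ell_infty S V\<^esub> h)" if "h \<in> carrier (ell_infty S V)"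
    using f g that by (auto simp: add_ell_infty fun_eq_iff ell_infty_apply_closed a_assoc)
  show "\<exists>g\<in>carrier (ell_infty S V). g \<oplus>\<^bsub>ell_infty S V\<^esub> f = \<zero>\<^bsub>ell_infty S V\<^esub>"
    using f ell_infty_uminus_closed ell_infty_uminus_add by blast
  have "(\<lambda>s\<in>S. \<zero> \<oplus> f s) = (\<lambda>s\<in>S. f s)"
    using f by (auto simp: fun_eq_iff ell_infty_apply_closed)
  also have "\<dots> = f"
    using f by (auto simp: carrier_ell_infty_iff PiE_iff extensional_restrict)
  finally show "\<zero>\<^bsub>ell_infty S V\<^esub> \<oplus>\<^bsub>ell_infty S V\<^esub> f = f"
    by (simp add: add_ell_infty zero_ell_infty cong: restrict_cong)
next
  show "\<zero>\<^bsub>ell_infty S V\<^esub> \<in> carrier (ell_infty S V)"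
    by (rule ell_inftyI[where b = 0]) (auto simp: zero_ell_infty norm_zero)
qed

lemma uminus_ell_infty:
  assumes "f \<in> carrier (ell_infty S V)"
  shows "\<ominus>\<^bsub>ell_infty S V\<^esub> f = (\<lambda>s\<in>S. \<ominus> f s)"
proof -
  interpret L: abelian_group "ell_infty S V"
    by (rule abelian_group_ell_infty)
  show ?thesis
    using assms by (intro L.minus_equality ell_infty_uminus_closed ell_infty_uminus_add)
qed

text \<open>The supremum of the empty set of reals is unspecified, hence the condition on
  \<open>S\<close>. It is applied to sets of tuples, which always contain a tuple of units.\<close>

lemma normed_group_ell_infty:
  assumes "S \<noteq> {}"
  shows "normed_group (ell_infty S V)"
proof -
  interpret L: abelian_group "ell_infty S V"
    by (rule abelian_group_ell_infty)
  show ?thesis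
  proof
    fix f assume f: "f \<in> carrier (ell_infty S V)"
    obtain s where "s \<in> S"
      using assms by blast
    with f have "0 \<le> vnorm V (f s)"
      by (auto simp: carrier_ell_infty_iff intro: norm_nonneg)
    then show "0 \<le> vnorm (ell_infty S V) f"
      using norm_le_vnorm_ell_infty[OF f \<open>s \<in> S\<close>] by linarith
    show "vnorm (ell_infty S V) (\<ominus>\<^bsub>ell_infty S V\<^esub> f) = vnorm (ell_infty S V) f"
      using f by (auto simp: uminus_ell_infty)
        (auto simp: ell_infty_def norm_minus PiE_iff intro!: SUP_cong)
  next
    show "vnorm (ell_infty S V) \<zero>\<^bsub>ell_infty S V\<^esub> = 0"
      using assms by (simp add: ell_infty_def norm_zero)
  next
    fix f g assume fg: "f \<in> carrier (ell_infty S V)" "g \<in> carrier (ell_infty S V)"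
    show "vnorm (ell_infty S V) (f \<oplus>\<^bsub>ell_infty S V\<^esub> g)
        \<le> vnorm (ell_infty S V) f + vnorm (ell_infty S V) g"
    proof (rule vnorm_ell_infty_le[OF assms])
      fix s assume s: "s \<in> S"
      then have "vnorm V ((f \<oplus>\<^bsub>ell_infty S V\<^esub> g) s) \<le> vnorm V (f s) + vnorm V (g s)"
        using fg by (auto simp: add_ell_infty carrier_ell_infty_iff intro: norm_triangle)
      then show "vnorm V ((f \<oplus>\<^bsub>ell_infty S V\<^esub> g) s)
          \<le> vnorm (ell_infty S V) f + vnorm (ell_infty S V) g"
        using norm_le_vnorm_ell_infty[OF fg(1) s] norm_le_vnorm_ell_infty[OF fg(2) s] by linarith
    qed
  qed
qed

end


section \<open>Ultraproducts of normed groups\<close>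

lemma carrier_bounded_sequences_iff:
  "x \<in> carrier (bounded_sequences V) \<longleftrightarrow>
    (\<forall>k. x k \<in> carrier (V k)) \<and> bdd_above (range (\<lambda>k. vnorm (V k) (x k)))"
  by (simp add: bounded_sequences_def)

lemma bounded_sequencesI:
  assumes "\<And>k. x k \<in> carrier (V k)" "\<And>k. vnorm (V k) (x k) \<le> b"
  shows "x \<in> carrier (bounded_sequences V)"
  using assms by (auto simp: carrier_bounded_sequences_iff intro!: bdd_aboveI2)

lemma bounded_sequencesE:
  assumes "x \<in> carrier (bounded_sequences V)"
  obtains b where "0 \<le> b" "\<And>k. vnorm (V k) (x k) \<le> b"
proof -
  obtain b where b: "\<And>k. vnorm (V k) (x k) \<le> b"
    using assms by (auto simp: carrier_bounded_sequences_iff bdd_above_def)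
  show thesis
  proof
    show "vnorm (V k) (x k) \<le> max b 0" for k
      using b[of k] by simp
  qed simp
qed

lemma add_bounded_sequences: "x \<oplus>\<^bsub>bounded_sequences V\<^esub> y = (\<lambda>k. x k \<oplus>\<^bsub>V k\<^esub> y k)"
  by (simp add: bounded_sequences_def)

lemma zero_bounded_sequences: "\<zero>\<^bsub>bounded_sequences V\<^esub> = (\<lambda>k. \<zero>\<^bsub>V k\<^esub>)"
  by (simp add: bounded_sequences_def)

locale normed_group_sequence =
  fixes V :: "nat \<Rightarrow> ('k, 'a) normed_module"
  assumes normed_group: "normed_group (V k)"
begin

sublocale V: normed_group "V k" for k
  by (rule normed_group)

sublocale bounded: abelian_group "bounded_sequences V"
proof (rule abelian_groupI)
  fix x y z
  assume x: "x \<in> carrier (bounded_sequences V)" and y: "y \<in> carrier (bounded_sequences V)"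
  have x_carrier: "x k \<in> carrier (V k)" and y_carrier: "y k \<in> carrier (V k)" for k
    using x y by (simp_all add: carrier_bounded_sequences_iff)
  obtain b c where b: "\<And>k. vnorm (V k) (x k) \<le> b" and c: "\<And>k. vnorm (V k) (y k) \<le> c"
    using bounded_sequencesE[OF x] bounded_sequencesE[OF y] by metis
  show "x \<oplus>\<^bsub>bounded_sequences V\<^esub> y \<in> carrier (bounded_sequences V)"
  proof (rule bounded_sequencesI)
    show "vnorm (V k) ((x \<oplus>\<^bsub>bounded_sequences V\<^esub> y) k) \<le> b + c" for k
      using V.norm_triangle[OF x_carrier y_carrier, of k] b[of k] c[of k]
      by (simp add: add_bounded_sequences)
  qed (simp add: add_bounded_sequences x_carrier y_carrier)
  show "x \<oplus>\<^bsub>bounded_sequences V\<^esub> y = y \<oplus>\<^bsub>bounded_sequences V\<^esub> x"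
    by (simp add: add_bounded_sequences x_carrier y_carrier V.a_comm)
  show "x \<oplus>\<^bsub>bounded_sequences V\<^esub> y \<oplus>\<^bsub>bounded_sequences V\<^esub> z
      = x \<oplus>\<^bsub>bounded_sequences V\<^esub> (y \<oplus>\<^bsub>bounded_sequences V\<^esub> z)"
    if "z \<in> carrier (bounded_sequences V)"
    using that
    by (simp add: add_bounded_sequences carrier_bounded_sequences_iff x_carrier y_carrier V.a_assoc)
  show "\<zero>\<^bsub>bounded_sequences V\<^esub> \<oplus>\<^bsub>bounded_sequences V\<^esub> x = x"
    by (simp add: add_bounded_sequences zero_bounded_sequences x_carrier)
  have "(\<lambda>k. \<ominus>\<^bsub>V k\<^esub> x k) \<in> carrier (bounded_sequences V)"
    by (rule bounded_sequencesI[where b = b]) (simp_all add: x_carrier V.norm_minus b)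
  then show "\<exists>y\<in>carrier (bounded_sequences V).
      y \<oplus>\<^bsub>bounded_sequences V\<^esub> x = \<zero>\<^bsub>bounded_sequences V\<^esub>"
    by (rule bexI[rotated])
      (simp add: add_bounded_sequences zero_bounded_sequences x_carrier V.l_neg)
next
  show "\<zero>\<^bsub>bounded_sequences V\<^esub> \<in> carrier (bounded_sequences V)"
    by (rule bounded_sequencesI[where b = 0]) (auto simp: zero_bounded_sequences V.norm_zero)
qed

lemma uminus_bounded_sequences:
  assumes "x \<in> carrier (bounded_sequences V)"
  shows "\<ominus>\<^bsub>bounded_sequences V\<^esub> x = (\<lambda>k. \<ominus>\<^bsub>V k\<^esub> x k)"
  using assms
  by (intro bounded.minus_equality)
    (auto simp: add_bounded_sequences zero_bounded_sequences carrier_bounded_sequences_iff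
      V.norm_minus V.l_neg)

lemma null_sequencesI:
  assumes "x \<in> carrier (bounded_sequences V)" "(h \<longlongrightarrow> 0) \<U>"
    and "\<And>k. vnorm (V k) (x k) \<le> h k"
  shows "x \<in> null_sequences \<U> V"
proof -
  have "\<forall>\<^sub>F k in \<U>. 0 \<le> vnorm (V k) (x k)" "\<forall>\<^sub>F k in \<U>. vnorm (V k) (x k) \<le> h k"
    using assms by (auto simp: carrier_bounded_sequences_iff V.norm_nonneg)
  then have "((\<lambda>k. vnorm (V k) (x k)) \<longlongrightarrow> 0) \<U>"
    by (rule real_tendsto_sandwich) (use assms in auto)
  with assms show ?thesis
    by (simp add: null_sequences_def)
qed

lemma abelian_subgroup_null_sequences:
  "abelian_subgroup (null_sequences \<U> V) (bounded_sequences V)"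
proof (rule abelian_subgroupI3)
  show "additive_subgroup (null_sequences \<U> V) (bounded_sequences V)"
  proof (rule additive_subgroup.intro, rule group.subgroupI[OF bounded.a_group])
    show "null_sequences \<U> V \<subseteq> carrier (add_monoid (bounded_sequences V))"
      by (auto simp: null_sequences_def)
    have "\<zero>\<^bsub>bounded_sequences V\<^esub> \<in> null_sequences \<U> V"
      using bounded.zero_closed
      by (auto simp: null_sequences_def zero_bounded_sequences V.norm_zero)
    then show "null_sequences \<U> V \<noteq> {}" by blast
  next
    fix x assume "x \<in> null_sequences \<U> V"
    then have "\<ominus>\<^bsub>bounded_sequences V\<^esub> x \<in> null_sequences \<U> V"
      using bounded.a_inv_closed[of x]
      by (auto simp: null_sequences_def uminus_bounded_sequences carrier_bounded_sequences_iff
          V.norm_minus)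
    then show "inv\<^bsub>add_monoid (bounded_sequences V)\<^esub> x \<in> null_sequences \<U> V"
      by (simp add: a_inv_def)
  next
    fix x y assume x: "x \<in> null_sequences \<U> V" and y: "y \<in> null_sequences \<U> V"
    have "x \<oplus>\<^bsub>bounded_sequences V\<^esub> y \<in> null_sequences \<U> V"
    proof (rule null_sequencesI)
      show "x \<oplus>\<^bsub>bounded_sequences V\<^esub> y \<in> carrier (bounded_sequences V)"
        using x y by (auto simp: null_sequences_def)
      show "((\<lambda>k. vnorm (V k) (x k) + vnorm (V k) (y k)) \<longlongrightarrow> 0) \<U>"
        using x y by (intro tendsto_add_zero) (auto simp: null_sequences_def)
      show "vnorm (V k) ((x \<oplus>\<^bsub>bounded_sequences V\<^esub> y) k)
          \<le> vnorm (V k) (x k) + vnorm (V k) (y k)" for k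
        using x y V.norm_triangle[of "x k" k "y k"]
        by (auto simp: null_sequences_def add_bounded_sequences carrier_bounded_sequences_iff)
    qed
    then show "x \<otimes>\<^bsub>add_monoid (bounded_sequences V)\<^esub> y \<in> null_sequences \<U> V"
      by simp
  qed
qed (rule bounded.abelian_group_axioms)

sublocale null: abelian_subgroup "null_sequences \<U> V" "bounded_sequences V" for \<U>
  by (rule abelian_subgroup_null_sequences)

lemma ultraclass_self:
  "x \<in> carrier (bounded_sequences V) \<Longrightarrow> x \<in> ultraclass \<U> V x"
  unfolding ultraclass_def by (rule null.a_rcos_self)

lemma ultraclass_eqI:
  assumes "x \<in> carrier (bounded_sequences V)" "y \<in> carrier (bounded_sequences V)"
    and "x \<ominus>\<^bsub>bounded_sequences V\<^esub> y \<in> null_sequences \<U> V"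
  shows "ultraclass \<U> V x = ultraclass \<U> V y"
proof -
  have "x = (x \<ominus>\<^bsub>bounded_sequences V\<^esub> y) \<oplus>\<^bsub>bounded_sequences V\<^esub> y"
    using assms by (simp add: a_minus_def bounded.a_assoc bounded.l_neg)
  then have "x \<in> ultraclass \<U> V y"
    using assms(3) by (auto simp: ultraclass_def a_r_coset_def')
  then show ?thesis
    using assms(2) unfolding ultraclass_def by (intro null.a_repr_independence'[symmetric])
qed

lemma carrier_ultraproduct:
  "carrier (ultraproduct \<U> V) = ultraclass \<U> V ` carrier (bounded_sequences V)"
  by (auto simp: ultraproduct_def quotient_space_def module.defs A_RCOSETS_def' ultraclass_def)

lemma zero_ultraproduct: "\<zero>\<^bsub>ultraproduct \<U> V\<^esub> = null_sequences \<U> V"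
  by (simp add: ultraproduct_def quotient_space_def module.defs)

lemma add_ultraclass:
  assumes "x \<in> carrier (bounded_sequences V)" "y \<in> carrier (bounded_sequences V)"
  shows "ultraclass \<U> V x \<oplus>\<^bsub>ultraproduct \<U> V\<^esub> ultraclass \<U> V y
    = ultraclass \<U> V (x \<oplus>\<^bsub>bounded_sequences V\<^esub> y)"
  using null.a_rcos_sum[OF assms]
  by (simp add: ultraproduct_def quotient_space_def module.defs ultraclass_def)

end

text \<open>One constant \<open>C\<close> serves all \<open>k\<close>: this keeps images of bounded
  sequences bounded and images of null sequences null. Additivity then makes the map compatible with
  cosets.\<close>

locale bounded_additive_sequence =
  V: normed_group_sequence V + W: normed_group_sequence W
  for V :: "nat \<Rightarrow> ('k, 'a) normed_module" and W :: "nat \<Rightarrow> ('l, 'b) normed_module" +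
  fixes f :: "nat \<Rightarrow> 'a \<Rightarrow> 'b" and C :: real
  assumes closed: "x \<in> carrier (V k) \<Longrightarrow> f k x \<in> carrier (W k)"
    and additive: "x \<in> carrier (V k) \<Longrightarrow> y \<in> carrier (V k) \<Longrightarrow>
      f k (x \<oplus>\<^bsub>V k\<^esub> y) = f k x \<oplus>\<^bsub>W k\<^esub> f k y"
    and bound: "x \<in> carrier (V k) \<Longrightarrow> vnorm (W k) (f k x) \<le> C * vnorm (V k) x"
    and bound_nonneg: "0 \<le> C"
begin

lemma image_bounded:
  assumes "x \<in> carrier (bounded_sequences V)"
  shows "(\<lambda>k. f k (x k)) \<in> carrier (bounded_sequences W)"
proof -
  obtain b where b: "\<And>k. vnorm (V k) (x k) \<le> b"
    using bounded_sequencesE[OF assms] by metis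
  show ?thesis
  proof (rule bounded_sequencesI)
    show "vnorm (W k) (f k (x k)) \<le> C * b" for k
      using bound[of "x k" k] assms mult_left_mono[OF b[of k] bound_nonneg]
      by (simp add: carrier_bounded_sequences_iff)
    show "f k (x k) \<in> carrier (W k)" for k
      using assms by (simp add: carrier_bounded_sequences_iff closed)
  qed
qed

lemma image_null:
  assumes "x \<in> null_sequences \<U> V"
  shows "(\<lambda>k. f k (x k)) \<in> null_sequences \<U> W"
proof -
  have x: "x \<in> carrier (bounded_sequences V)"
    and null: "((\<lambda>k. vnorm (V k) (x k)) \<longlongrightarrow> 0) \<U>"
    using assms unfolding null_sequences_def by blast+
  have "x k \<in> carrier (V k)" for k
    using x by (simp add: carrier_bounded_sequences_iff)
  then show ?thesis
    using W.null_sequencesI[OF image_bounded[OF x] tendsto_mult_right_zero[OF null] bound] by simp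
qed

text \<open>Two representatives of a class differ by a null sequence, and so do their images. Hence
  the union defining \<open>ultramap\<close> runs over equal cosets, and it is a nonempty union
  because \<open>x\<close> represents its own class.\<close>

lemma ultramap_ultraclass:
  assumes x: "x \<in> carrier (bounded_sequences V)"
  shows "ultramap \<U> W f (ultraclass \<U> V x) = ultraclass \<U> W (\<lambda>k. f k (x k))"
proof -
  have "ultraclass \<U> W (\<lambda>k. f k (y k)) = ultraclass \<U> W (\<lambda>k. f k (x k))"
    if y: "y \<in> ultraclass \<U> V x" for y
  proof -
    obtain n where n: "n \<in> null_sequences \<U> V" and y_eq: "y = n \<oplus>\<^bsub>bounded_sequences V\<^esub> x"
      using y by (auto simp: ultraclass_def a_r_coset_def')
    have "(\<lambda>k. f k (y k)) = (\<lambda>k. f k (n k)) \<oplus>\<^bsub>bounded_sequences W\<^esub> (\<lambda>k. f k (x k))"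
      using n x
      by (simp add: y_eq null_sequences_def add_bounded_sequences carrier_bounded_sequences_iff
          additive)
    also have "\<dots> \<in> ultraclass \<U> W (\<lambda>k. f k (x k))"
      unfolding ultraclass_def
      by (rule W.bounded.a_rcosI[OF image_null[OF n] W.null.a_subset image_bounded[OF x]])
    finally have "(\<lambda>k. f k (y k)) \<in> ultraclass \<U> W (\<lambda>k. f k (x k))" .
    then show ?thesis
      using image_bounded[OF x]
      unfolding ultraclass_def by (intro W.null.a_repr_independence'[symmetric])
  qed
  then have "ultramap \<U> W f (ultraclass \<U> V x)
      = (\<Union>y\<in>ultraclass \<U> V x. ultraclass \<U> W (\<lambda>k. f k (x k)))"
    unfolding ultramap_def by (rule SUP_cong[OF refl])
  also have "\<dots> = ultraclass \<U> W (\<lambda>k. f k (x k))"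
    using V.ultraclass_self[OF x] by (intro SUP_const) blast
  finally show ?thesis .
qed

end

text \<open>An ultrafilter containing a singleton is the principal one at that point. So the
  complement of each point, and then each cofinite set, belongs to \<open>\<U>\<close>; ordinary
  limits of sequences become limits along \<open>\<U>\<close>.\<close>

lemma nonprincipal_ultrafilter_le_sequentially:
  assumes "nonprincipal_ultrafilter \<U>"
  shows "\<U> \<le> sequentially"
proof -
  have ne: "\<forall>\<^sub>F k in \<U>. k \<noteq> n" for n
  proof (rule ccontr)
    assume "\<not> (\<forall>\<^sub>F k in \<U>. k \<noteq> n)"
    then have n: "\<forall>\<^sub>F k in \<U>. k = n"
      using assms by (metis (mono_tags, lifting) eventually_mono nonprincipal_ultrafilter_def)
    have "eventually P \<U> \<longleftrightarrow> P n" for P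
    proof
      assume "eventually P \<U>"
      with n have "\<forall>\<^sub>F k in \<U>. P n"
        by eventually_elim auto
      then show "P n"
        using assms by (simp add: nonprincipal_ultrafilter_def eventually_const_iff)
    next
      assume "P n"
      then show "eventually P \<U>"
        using n by (auto elim: eventually_mono)
    qed
    then have "\<U> = principal {n}"
      by (simp add: filter_eq_iff eventually_principal)
    with assms show False
      by (simp add: nonprincipal_ultrafilter_def)
  qed
  have "\<forall>\<^sub>F k in \<U>. N \<le> k" for N
  proof -
    have "\<forall>\<^sub>F k in \<U>. \<forall>n\<in>{..<N}. k \<noteq> n"
      using ne by (intro eventually_ball_finite) auto
    then show ?thesis
      by eventually_elim (use not_le in blast)
  qed
  then show ?thesis
    by (force simp: le_filter_def eventually_sequentially elim: eventually_mono)
qed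


section \<open>The codifferential\<close>

lemma tuples_0: "tuples \<Gamma> 0 = {[]}"
  by (auto simp: tuples_def)

lemma tuples_1: "tuples \<Gamma> 1 = (\<lambda>g. [g]) ` carrier \<Gamma>"
  by (auto simp: tuples_def length_Suc_conv)

locale isometric_maps = banach_space V + G: group \<Gamma>
  for V :: "('k::real_normed_field, 'a) normed_module" (structure)
    and \<Gamma> :: "('g, 'm) monoid_scheme" +
  fixes \<rho> :: "'g \<Rightarrow> 'a \<Rightarrow> 'a"
  assumes isometry: "g \<in> carrier \<Gamma> \<Longrightarrow> \<rho> g \<in> linear_isometries V"
begin

lemma map_closed [simp]: "g \<in> carrier \<Gamma> \<Longrightarrow> x \<in> carrier V \<Longrightarrow> \<rho> g x \<in> carrier V"
  using isometry[of g] by (auto simp: linear_isometries_def Bij_def bij_betw_def)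

lemma map_add:
  "g \<in> carrier \<Gamma> \<Longrightarrow> x \<in> carrier V \<Longrightarrow> y \<in> carrier V \<Longrightarrow> \<rho> g (x \<oplus> y) = \<rho> g x \<oplus> \<rho> g y"
  using isometry[of g] by (auto simp: linear_isometries_def)

lemma map_uminus: "g \<in> carrier \<Gamma> \<Longrightarrow> x \<in> carrier V \<Longrightarrow> \<rho> g (\<ominus> x) = \<ominus> \<rho> g x"
  using isometry[of g] by (auto simp: linear_isometries_def minus_one_smult[symmetric])

lemma map_diff:
  "g \<in> carrier \<Gamma> \<Longrightarrow> x \<in> carrier V \<Longrightarrow> y \<in> carrier V \<Longrightarrow> \<rho> g (x \<ominus> y) = \<rho> g x \<ominus> \<rho> g y"
  by (simp add: a_minus_def map_add map_uminus)

lemma norm_map: "g \<in> carrier \<Gamma> \<Longrightarrow> x \<in> carrier V \<Longrightarrow> vnorm V (\<rho> g x) = vnorm V x"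
  using isometry[of g] by (auto simp: linear_isometries_def)

lemma tuples_nonempty: "tuples \<Gamma> n \<noteq> {}"
proof -
  have "replicate n \<one>\<^bsub>\<Gamma>\<^esub> \<in> tuples \<Gamma> n"
    by (auto simp: tuples_def)
  then show ?thesis by blast
qed

text \<open>The arguments at which \<open>codifferential\<close> evaluates a cochain. Merging
  positions \<open>i - 1\<close> and \<open>i\<close> leaves
  \<open>(i - 1) + 1 + (n - i) = n\<close> entries.\<close>

lemma faces_in_tuples:
  assumes "gs \<in> tuples \<Gamma> (Suc n)"
  shows "hd gs \<in> carrier \<Gamma>" "tl gs \<in> tuples \<Gamma> n" "butlast gs \<in> tuples \<Gamma> n"
    and "i \<in> {1..<Suc n} \<Longrightarrow>
      take (i - 1) gs @ [gs ! (i - 1) \<otimes>\<^bsub>\<Gamma>\<^esub> gs ! i] @ drop (i + 1) gs \<in> tuples \<Gamma> n"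
proof -
  have gs: "length gs = Suc n" "set gs \<subseteq> carrier \<Gamma>"
    using assms by (auto simp: tuples_def)
  then show "hd gs \<in> carrier \<Gamma>" "tl gs \<in> tuples \<Gamma> n" "butlast gs \<in> tuples \<Gamma> n"
    by (cases gs; force simp: tuples_def dest: in_set_butlastD)+
  assume i: "i \<in> {1..<Suc n}"
  then have "gs ! (i - 1) \<in> carrier \<Gamma>" "gs ! i \<in> carrier \<Gamma>"
    using gs by (auto simp: subset_iff)
  with gs i show "take (i - 1) gs @ [gs ! (i - 1) \<otimes>\<^bsub>\<Gamma>\<^esub> gs ! i] @ drop (i + 1) gs \<in> tuples \<Gamma> n"
    by (auto simp: tuples_def dest!: in_set_takeD in_set_dropD)
qed

lemma codifferential_apply_closed:
  assumes f: "f \<in> carrier (ell_infty (tuples \<Gamma> n) V)" and gs: "gs \<in> tuples \<Gamma> (Suc n)"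
  shows "codifferential \<Gamma> V \<rho> (Suc n) f gs \<in> carrier V"
  using gs faces_in_tuples[OF gs] ell_infty_apply_closed[OF f]
  by (auto simp: codifferential_def intro!: a_closed finsum_closed smult_closed' map_closed)

text \<open>The factor counts summands: the first, the last and \<open>n\<close> merged ones, each
  of norm at most that of \<open>f\<close>, since \<open>\<rho> (hd gs)\<close> is isometric and
  signs have norm 1. It depends on the degree only, so it is uniform over a sequence of
  modules.\<close>

lemma norm_codifferential_apply:
  assumes f: "f \<in> carrier (ell_infty (tuples \<Gamma> n) V)" and gs: "gs \<in> tuples \<Gamma> (Suc n)"
  shows "vnorm V (codifferential \<Gamma> V \<rho> (Suc n) f gs)
    \<le> real (n + 2) * vnorm (ell_infty (tuples \<Gamma> n) V) f"
proof -
  let ?b = "vnorm (ell_infty (tuples \<Gamma> n) V) f"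
  let ?h = "\<lambda>i. (- 1) ^ i \<odot> f (take (i - 1) gs @ [gs ! (i - 1) \<otimes>\<^bsub>\<Gamma>\<^esub> gs ! i] @ drop (i + 1) gs)"
  note faces = faces_in_tuples[OF gs]
  note closed = ell_infty_apply_closed[OF f]
  note le = norm_le_vnorm_ell_infty[OF f]
  have h: "?h i \<in> carrier V" "vnorm V (?h i) \<le> ?b" if "i \<in> {1..<Suc n}" for i
    using closed[OF faces(4)[OF that]] le[OF faces(4)[OF that]]
    by (simp_all add: vnorm_smult norm_power)
  have "vnorm V (\<Oplus>i\<in>{1..<Suc n}. ?h i) \<le> (\<Sum>i\<in>{1..<Suc n}. vnorm V (?h i))"
    using h by (intro norm_finsum) blast
  also have "\<dots> \<le> n * ?b"
    using sum_bounded_above[of "{1..<Suc n}" "\<lambda>i. vnorm V (?h i)" ?b] h by simp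
  finally have middle: "vnorm V (\<Oplus>i\<in>{1..<Suc n}. ?h i) \<le> n * ?b" .
  have first: "\<rho> (hd gs) (f (tl gs)) \<in> carrier V" "vnorm V (\<rho> (hd gs) (f (tl gs))) \<le> ?b"
    using faces closed le by (simp_all add: norm_map)
  have last: "(- 1) ^ Suc n \<odot> f (butlast gs) \<in> carrier V"
      "vnorm V ((- 1) ^ Suc n \<odot> f (butlast gs)) \<le> ?b"
    using closed[OF faces(3)] le[OF faces(3)]
    by (simp_all only: smult_closed' vnorm_smult norm_power norm_minus_cancel norm_one power_one
        mult_1_left)
  have sum: "(\<Oplus>i\<in>{1..<Suc n}. ?h i) \<in> carrier V"
    using h by (intro finsum_closed) blast
  have "vnorm V (codifferential \<Gamma> V \<rho> (Suc n) f gs) \<le> ?b + n * ?b + ?b"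
    using gs norm_triangle[OF a_closed[OF first(1) sum] last(1)] norm_triangle[OF first(1) sum]
      first(2) middle last(2)
    unfolding codifferential_def restrict_apply if_P[OF gs] by linarith
  then show ?thesis
    by (simp add: algebra_simps)
qed

lemma codifferential_closed:
  assumes "f \<in> carrier (ell_infty (tuples \<Gamma> n) V)"
  shows "codifferential \<Gamma> V \<rho> (Suc n) f \<in> carrier (ell_infty (tuples \<Gamma> (Suc n)) V)"
proof (rule ell_inftyI[OF _ norm_codifferential_apply[OF assms]])
  have "codifferential \<Gamma> V \<rho> (Suc n) f \<in> extensional (tuples \<Gamma> (Suc n))"
    by (simp add: codifferential_def)
  with codifferential_apply_closed[OF assms]
  show "codifferential \<Gamma> V \<rho> (Suc n) f \<in> tuples \<Gamma> (Suc n) \<rightarrow>\<^sub>E carrier V"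
    by (simp add: PiE_iff)
qed

lemma codifferential_add:
  assumes f: "f \<in> carrier (ell_infty (tuples \<Gamma> n) V)"
    and g: "g \<in> carrier (ell_infty (tuples \<Gamma> n) V)"
  shows "codifferential \<Gamma> V \<rho> (Suc n) (f \<oplus>\<^bsub>ell_infty (tuples \<Gamma> n) V\<^esub> g)
    = codifferential \<Gamma> V \<rho> (Suc n) f \<oplus>\<^bsub>ell_infty (tuples \<Gamma> (Suc n)) V\<^esub>
      codifferential \<Gamma> V \<rho> (Suc n) g"
proof
  fix gs
  let ?f = "f \<oplus>\<^bsub>ell_infty (tuples \<Gamma> n) V\<^esub> g"
  show "codifferential \<Gamma> V \<rho> (Suc n) ?f gs
    = (codifferential \<Gamma> V \<rho> (Suc n) f \<oplus>\<^bsub>ell_infty (tuples \<Gamma> (Suc n)) V\<^esub>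
      codifferential \<Gamma> V \<rho> (Suc n) g) gs"
  proof (cases "gs \<in> tuples \<Gamma> (Suc n)")
    case False
    then show ?thesis
      by (simp add: codifferential_def add_ell_infty)
  next
    case True
    let ?face = "\<lambda>i. take (i - 1) gs @ [gs ! (i - 1) \<otimes>\<^bsub>\<Gamma>\<^esub> gs ! i] @ drop (i + 1) gs"
    let ?s = "\<lambda>f. \<Oplus>i\<in>{1..<Suc n}. (- 1) ^ i \<odot> f (?face i)"
    let ?a = "\<lambda>f. \<rho> (hd gs) (f (tl gs))"
    let ?z = "\<lambda>f. (- 1) ^ Suc n \<odot> f (butlast gs)"
    note faces = faces_in_tuples[OF True]
    note closed = ell_infty_apply_closed[OF f] ell_infty_apply_closed[OF g]
    have face: "f (?face i) \<in> carrier V" "g (?face i) \<in> carrier V"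
        "?f (?face i) = f (?face i) \<oplus> g (?face i)" if "i \<in> {1..<Suc n}" for i
      using faces(4)[OF that] closed by (simp_all add: add_ell_infty)
    have "?s ?f = (\<Oplus>i\<in>{1..<Suc n}. (- 1) ^ i \<odot> f (?face i) \<oplus> (- 1) ^ i \<odot> g (?face i))"
      using face by (intro finsum_cong') (auto simp only: smult_add smult_closed' a_closed
          intro!: funcsetI)
    also have "\<dots> = ?s f \<oplus> ?s g"
      using face by (intro finsum_addf) (auto simp only: smult_closed' intro!: funcsetI)
    finally have s: "?s ?f = ?s f \<oplus> ?s g" .
    have a: "?a ?f = ?a f \<oplus> ?a g"
      using faces closed by (simp add: add_ell_infty map_add)
    have z: "?z ?f = ?z f \<oplus> ?z g"
      using faces closed by (simp add: add_ell_infty smult_add del: power_Suc)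
    have s_closed: "?s f \<in> carrier V" "?s g \<in> carrier V"
      using face by (intro finsum_closed; auto simp only: smult_closed' intro!: funcsetI)+
    have az_closed: "?a f \<in> carrier V" "?a g \<in> carrier V" "?z f \<in> carrier V" "?z g \<in> carrier V"
      using faces closed by simp_all
    have "?a ?f \<oplus> ?s ?f \<oplus> ?z ?f = (?a f \<oplus> ?s f \<oplus> ?z f) \<oplus> (?a g \<oplus> ?s g \<oplus> ?z g)"
      unfolding s a z
      using s_closed az_closed by (simp only: a_ac a_closed)
    with True show ?thesis
      by (simp only: codifferential_def add_ell_infty restrict_apply if_True)
  qed
qed

lemma codifferential_1:
  assumes "f [] \<in> carrier V" "g \<in> carrier \<Gamma>"
  shows "codifferential \<Gamma> V \<rho> 1 f [g] = \<rho> g (f []) \<ominus> f []"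
  using assms by (simp add: codifferential_def tuples_def minus_one_smult a_minus_def)

text \<open>The right-hand side is the defect of the affine maps
  \<open>x \<mapsto> \<rho> g x \<oplus> f [g]\<close> as an action, tested at 0: the image under
  \<open>g\<close> of the image under \<open>h\<close>, minus the image under the product.\<close>

lemma codifferential_2:
  assumes "\<And>g. g \<in> carrier \<Gamma> \<Longrightarrow> f [g] \<in> carrier V" "g \<in> carrier \<Gamma>" "h \<in> carrier \<Gamma>"
  shows "codifferential \<Gamma> V \<rho> 2 f [g, h] = \<rho> g (f [h]) \<ominus> f [g \<otimes>\<^bsub>\<Gamma>\<^esub> h] \<oplus> f [g]"
proof -
  have "{1..<2} = {1::nat}"
    by auto
  then show ?thesis
    using assms by (simp add: codifferential_def tuples_def minus_one_smult a_minus_def)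
qed

end


section \<open>Almost fixed points\<close>

text \<open>The typical use has a point \<open>a\<close> seen from two centres \<open>x\<close> and
  \<open>y\<close>: the two position vectors differ by a vector that is the same for all points, so
  convexity can be applied at every point with the same gap.\<close>

lemma (in abelian_group) diff_diff_diff:
  assumes "a \<in> carrier G" "x \<in> carrier G" "y \<in> carrier G"
  shows "(a \<ominus> x) \<ominus> (a \<ominus> y) = y \<ominus> x"
proof -
  have "(a \<ominus> x) \<ominus> (a \<ominus> y) = (a \<oplus> \<ominus> a) \<oplus> (y \<oplus> \<ominus> x)"
    using assms by (simp add: a_minus_def minus_add a_ac del: r_neg)
  with assms show ?thesis
    by (simp add: a_minus_def r_neg)
qed

context banach_space
begin

text \<open>The radius about \<open>w\<close> is the supremum of the distances from
  \<open>w\<close>; \<open>v\<close> has a radius less than \<open>\<eta>\<close> above the infimum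
  over all \<open>w\<close>, and \<open>r\<close> is the radius about \<open>v\<close>.
  Near-minimality is phrased through a far point for every competitor \<open>w\<close>, which is the
  witness that a competitor with too small a radius contradicts.\<close>

lemma approximate_center:
  assumes S: "S \<noteq> {}" and c: "\<And>s. s \<in> S \<Longrightarrow> c s \<in> carrier V"
    and bound: "\<And>s. s \<in> S \<Longrightarrow> vnorm V (c s) \<le> C" and "0 < \<eta>"
  obtains v r where "v \<in> carrier V" "\<And>s. s \<in> S \<Longrightarrow> vnorm V (c s \<ominus> v) \<le> r"
    and "\<And>w. w \<in> carrier V \<Longrightarrow> \<exists>s\<in>S. r - \<eta> < vnorm V (c s \<ominus> w)"
proof -
  define radius where "radius w = (SUP s\<in>S. vnorm V (c s \<ominus> w))" for w
  define R where "R = (INF w\<in>carrier V. radius w)"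
  have bdd: "bdd_above ((\<lambda>s. vnorm V (c s \<ominus> w)) ` S)" if "w \<in> carrier V" for w
  proof (rule bdd_aboveI2)
    show "vnorm V (c s \<ominus> w) \<le> C + vnorm V w" if "s \<in> S" for s
      using norm_triangle_minus[of "c s" w] c bound[OF that] \<open>w \<in> carrier V\<close> that by fastforce
  qed
  obtain s0 where s0: "s0 \<in> S"
    using S by blast
  have "0 \<le> radius w" if "w \<in> carrier V" for w
  proof -
    have "vnorm V (c s0 \<ominus> w) \<le> radius w"
      unfolding radius_def by (rule cSUP_upper[OF s0 bdd[OF that]])
    moreover have "0 \<le> vnorm V (c s0 \<ominus> w)"
      using c[OF s0] that by (intro vnorm_nonneg minus_closed)
    ultimately show ?thesis by linarith
  qed
  then have bdd_below: "bdd_below (radius ` carrier V)"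
    by (rule bdd_belowI2)
  have "radius ` carrier V \<noteq> {}"
    using zero_closed by blast
  then obtain v where v: "v \<in> carrier V" "radius v < R + \<eta>"
    using cInf_lessD[of "radius ` carrier V" "R + \<eta>"] \<open>0 < \<eta>\<close> by (auto simp: R_def)
  show thesis
  proof
    show "v \<in> carrier V" by fact
    show "vnorm V (c s \<ominus> v) \<le> radius v" if "s \<in> S" for s
      unfolding radius_def by (rule cSUP_upper[OF that bdd[OF v(1)]])
    show "\<exists>s\<in>S. radius v - \<eta> < vnorm V (c s \<ominus> w)" if "w \<in> carrier V" for w
    proof -
      have "radius v - \<eta> < radius w"
        using v cINF_lower[OF bdd_below that] by (simp add: R_def)
      then show ?thesis
        unfolding radius_def less_cSUP_iff[OF S bdd[OF that]] .
    qed
  qed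
qed

text \<open>Division by \<open>r\<close> takes both vectors into the unit ball and the gap
  \<open>t\<close> to \<open>t / r\<close>. The triangle inequality gives
  \<open>t \<le> 2 * r\<close>, which provides both \<open>0 < r\<close> and an argument in the
  domain of \<open>\<delta>\<close>.\<close>

lemma midpoint_bound:
  assumes convex: "\<And>\<epsilon> u v. \<epsilon> \<in> {0<..2} \<Longrightarrow> u \<in> carrier V \<Longrightarrow> v \<in> carrier V \<Longrightarrow>
      vnorm V u \<le> 1 \<Longrightarrow> vnorm V v \<le> 1 \<Longrightarrow> \<epsilon> \<le> vnorm V (u \<ominus> v) \<Longrightarrow>
      vnorm V ((1/2) \<odot> (u \<oplus> v)) \<le> 1 - \<delta> \<epsilon>"
    and a: "a \<in> carrier V" "vnorm V a \<le> r" and b: "b \<in> carrier V" "vnorm V b \<le> r"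
    and t: "0 < t" "t \<le> vnorm V (a \<ominus> b)"
  shows "vnorm V ((1/2) \<odot> (a \<oplus> b)) \<le> r * (1 - \<delta> (t / r))"
proof -
  have "t \<le> 2 * r"
    using norm_triangle_minus[OF a(1) b(1)] a(2) b(2) t(2) by linarith
  with t have r: "0 < r" "t / r \<in> {0<..2}"
    by (auto simp: field_simps)
  \<comment> \<open>The scalar field is an arbitrary real normed field, so the real factor is
    embedded by \<open>of_real\<close>, which preserves its absolute value.\<close>
  let ?c = "of_real (1 / r) :: 'k"
  have scale: "vnorm V (?c \<odot> x) = vnorm V x / r" if "x \<in> carrier V" for x
    using that r(1) vnorm_smult[of x ?c] by (simp only: norm_of_real) simp
  have "vnorm V ((1/2) \<odot> (?c \<odot> a \<oplus> ?c \<odot> b)) \<le> 1 - \<delta> (t / r)"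
  proof (rule convex[OF r(2)])
    show "t / r \<le> vnorm V (?c \<odot> a \<ominus> ?c \<odot> b)"
      using a b t r scale[of "a \<ominus> b"] by (simp add: smult_diff divide_right_mono)
  qed (use a b r scale in auto)
  moreover have "(1/2) \<odot> (?c \<odot> a \<oplus> ?c \<odot> b) = ?c \<odot> ((1/2) \<odot> (a \<oplus> b))"
    using a b by (simp only: smult_add[symmetric] smult_smult a_closed mult.commute)
  ultimately have "vnorm V ((1/2) \<odot> (a \<oplus> b)) / r \<le> 1 - \<delta> (t / r)"
    using a b scale[of "(1/2) \<odot> (a \<oplus> b)"] by simp
  with r(1) show ?thesis
    by (simp add: field_simps)
qed

end

context isometric_maps
begin

text \<open>
  The affine isometry \<open>x \<mapsto> \<rho> g x \<oplus> c g\<close> maps the set of values of \<open>c\<close> into itself up to \<open>\<epsilon>\<close>, so it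
  sends an approximate centre to an approximate centre. If the two were far apart, their midpoint
  would be a centre with a radius that is too small.
\<close>

lemma almost_fixed_point:
  assumes convex: "\<And>\<epsilon> u v. \<epsilon> \<in> {0<..2} \<Longrightarrow> u \<in> carrier V \<Longrightarrow> v \<in> carrier V \<Longrightarrow>
      vnorm V u \<le> 1 \<Longrightarrow> vnorm V v \<le> 1 \<Longrightarrow> \<epsilon> \<le> vnorm V (u \<ominus> v) \<Longrightarrow>
      vnorm V ((1/2) \<odot> (u \<oplus> v)) \<le> 1 - \<delta> \<epsilon>"
    and \<delta>: "mono_on {0<..2} \<delta>" "\<delta> \<in> {0<..2} \<rightarrow> {0<..1}"
    and c: "\<And>g. g \<in> carrier \<Gamma> \<Longrightarrow> c g \<in> carrier V"
    and bound: "\<And>g. g \<in> carrier \<Gamma> \<Longrightarrow> vnorm V (c g) \<le> C"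
    and cocycle: "\<And>g h. g \<in> carrier \<Gamma> \<Longrightarrow> h \<in> carrier \<Gamma> \<Longrightarrow>
      vnorm V (\<rho> g (c h) \<ominus> c (g \<otimes>\<^bsub>\<Gamma>\<^esub> h) \<oplus> c g) \<le> \<epsilon>"
    and v: "v \<in> carrier V" "\<And>g. g \<in> carrier \<Gamma> \<Longrightarrow> vnorm V (c g \<ominus> v) \<le> r"
    and center: "\<And>w. w \<in> carrier V \<Longrightarrow> \<exists>g\<in>carrier \<Gamma>. r - \<eta> < vnorm V (c g \<ominus> w)"
    and "0 \<le> \<epsilon>" and t: "0 < t" "t \<le> 2 * (C + 1)"
    and small: "\<eta> + \<epsilon> \<le> 1" "\<eta> + \<epsilon> \<le> t / 2 * \<delta> (t / (C + 1))"
    and g: "g \<in> carrier \<Gamma>"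
  shows "vnorm V (\<rho> g v \<oplus> c g \<ominus> v) < t"
proof (rule ccontr)
  assume "\<not> vnorm V (\<rho> g v \<oplus> c g \<ominus> v) < t"
  define z where "z = \<rho> g v \<oplus> c g"
  have z: "z \<in> carrier V"
    using g v c by (simp add: z_def)
  have far: "t \<le> vnorm V (z \<ominus> v)"
    using \<open>\<not> _\<close> by (simp add: z_def)
  have near_z: "vnorm V (c \<gamma> \<ominus> z) \<le> r + \<epsilon>" if \<gamma>: "\<gamma> \<in> carrier \<Gamma>" for \<gamma>
  proof -
    \<comment> \<open>Every value \<open>c \<gamma>\<close> is almost the image of a value: the
      affine map of \<open>g\<close> sends \<open>c h\<close> to
      \<open>c \<gamma> \<oplus> e\<close>, where \<open>e\<close> is the cocycle defect. It sends
      \<open>v\<close> to \<open>z\<close>, so the distance from \<open>c h\<close> to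
      \<open>v\<close> carries over up to \<open>\<epsilon>\<close>.\<close>
    define h where "h = inv\<^bsub>\<Gamma>\<^esub> g \<otimes>\<^bsub>\<Gamma>\<^esub> \<gamma>"
    have h: "h \<in> carrier \<Gamma>" "g \<otimes>\<^bsub>\<Gamma>\<^esub> h = \<gamma>"
      using g \<gamma> by (simp_all add: h_def G.m_assoc[symmetric])
    define e where "e = \<rho> g (c h) \<ominus> c \<gamma> \<oplus> c g"
    have e: "e \<in> carrier V" "vnorm V e \<le> \<epsilon>"
      using g h \<gamma> c cocycle[OF g h(1)] by (simp_all add: e_def)
    have "e = \<rho> g (c h) \<ominus> (c \<gamma> \<ominus> c g)"
      using g h \<gamma> c by (simp add: e_def a_minus_def minus_add a_assoc)
    then have "\<rho> g (c h \<ominus> v) \<ominus> e = (c \<gamma> \<ominus> c g) \<ominus> \<rho> g v"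
      using g h \<gamma> c v diff_diff_diff[of "\<rho> g (c h)" "\<rho> g v" "c \<gamma> \<ominus> c g"]
      by (simp add: map_diff)
    also have "\<dots> = c \<gamma> \<ominus> z"
      using g \<gamma> c v by (simp add: z_def a_minus_def minus_add a_ac)
    finally have "vnorm V (c \<gamma> \<ominus> z) \<le> vnorm V (\<rho> g (c h \<ominus> v)) + vnorm V e"
      using norm_triangle_minus[of "\<rho> g (c h \<ominus> v)" e] g h c v e by simp
    also have "\<dots> \<le> r + \<epsilon>"
      using g h c v(1) v(2)[OF h(1)] e by (simp add: norm_map)
    finally show ?thesis .
  qed
  define m where "m = (1/2) \<odot> (v \<oplus> z)"
  have m: "m \<in> carrier V"
    using v z by (simp add: m_def)
  obtain \<gamma> where \<gamma>: "\<gamma> \<in> carrier \<Gamma>" and lower: "r - \<eta> < vnorm V (c \<gamma> \<ominus> m)"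
    using center[OF m] by blast
  have x: "c \<gamma> \<in> carrier V"
    using c \<gamma> by blast
  \<comment> \<open>Doubling \<open>c \<gamma>\<close> exhibits
    \<open>c \<gamma> \<ominus> m\<close> as the average of \<open>c \<gamma> \<ominus> v\<close>
    and \<open>c \<gamma> \<ominus> z\<close>. Both have norm at most \<open>r + \<epsilon>\<close>,
    and their difference is \<open>z \<ominus> v\<close>.\<close>
  have "c \<gamma> = (1/2) \<odot> (c \<gamma> \<oplus> c \<gamma>)"
    using x add_smult[of "c \<gamma>" "1/2" "1/2"] by (simp add: smult_add)
  then have "c \<gamma> \<ominus> m = (1/2) \<odot> (c \<gamma> \<oplus> c \<gamma>) \<ominus> (1/2) \<odot> (v \<oplus> z)"
    by (simp add: m_def)
  also have "\<dots> = (1/2) \<odot> ((c \<gamma> \<oplus> c \<gamma>) \<ominus> (v \<oplus> z))"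
    using x v z by (simp add: smult_diff)
  also have "(c \<gamma> \<oplus> c \<gamma>) \<ominus> (v \<oplus> z) = (c \<gamma> \<ominus> v) \<oplus> (c \<gamma> \<ominus> z)"
    using x v(1) z by (simp add: a_minus_def minus_add a_ac)
  finally have midpoint: "c \<gamma> \<ominus> m = (1/2) \<odot> ((c \<gamma> \<ominus> v) \<oplus> (c \<gamma> \<ominus> z))" .
  have diff: "(c \<gamma> \<ominus> v) \<ominus> (c \<gamma> \<ominus> z) = z \<ominus> v"
    using x v(1) z by (rule diff_diff_diff)
  have near_v: "vnorm V (c \<gamma> \<ominus> v) \<le> r + \<epsilon>"
    using v(2)[OF \<gamma>] \<open>0 \<le> \<epsilon>\<close> by linarith
  have upper: "vnorm V (c \<gamma> \<ominus> m) \<le> (r + \<epsilon>) * (1 - \<delta> (t / (r + \<epsilon>)))"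
    unfolding midpoint
  proof (rule midpoint_bound[OF convex])
    show "t \<le> vnorm V (c \<gamma> \<ominus> v \<ominus> (c \<gamma> \<ominus> z))"
      unfolding diff by (rule far)
  qed (use x v(1) z near_v near_z[OF \<gamma>] t(1) in simp_all)
  have "t \<le> vnorm V (c \<gamma> \<ominus> v) + vnorm V (c \<gamma> \<ominus> z)"
    using norm_triangle_minus[of "c \<gamma> \<ominus> v" "c \<gamma> \<ominus> z"] x v(1) z far by (simp add: diff)
  then have r_lower: "t / 2 \<le> r + \<epsilon>"
    using near_v near_z[OF \<gamma>] by linarith
  \<comment> \<open>The competitor 0 has radius at most \<open>C\<close>, so near-minimality bounds
    \<open>r\<close> by \<open>C + \<eta>\<close>.\<close>
  obtain g0 where "g0 \<in> carrier \<Gamma>" "r - \<eta> < vnorm V (c g0 \<ominus> \<zero>)"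
    using center[OF zero_closed] by blast
  then have r_upper: "r + \<epsilon> < C + 1"
    using norm_triangle_minus[OF c zero_closed, of g0] bound[of g0] small(1)
    by (simp add: norm_zero)
  have "0 < r + \<epsilon>"
    using r_lower t(1) by linarith
  \<comment> \<open>Now \<open>r\<close> is eliminated: monotonicity replaces it by
    \<open>C + 1\<close> inside \<open>\<delta>\<close>, and \<open>t / 2\<close> bounds the factor
    in front from below. Since \<open>lower\<close> and \<open>upper\<close> force \<open>(r +
    \<epsilon>) * \<delta> (t / (r + \<epsilon>)) < \<eta> + \<epsilon>\<close>, this contradicts
    \<open>small(2)\<close>.\<close>
  then have "t / (C + 1) \<le> t / (r + \<epsilon>)"
    using r_upper t(1) by (intro divide_left_mono) (auto intro: mult_pos_pos)
  moreover have "t / (C + 1) \<in> {0<..2}" "t / (r + \<epsilon>) \<in> {0<..2}"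
    using r_lower r_upper \<open>0 < r + \<epsilon>\<close> t by (auto simp: field_simps)
  ultimately have "\<delta> (t / (C + 1)) \<le> \<delta> (t / (r + \<epsilon>))" "0 < \<delta> (t / (C + 1))"
    using \<delta> by (auto simp: mono_on_def Pi_iff)
  then have "t / 2 * \<delta> (t / (C + 1)) \<le> (r + \<epsilon>) * \<delta> (t / (r + \<epsilon>))"
    using r_lower t(1) by (intro mult_mono) auto
  with upper lower small(2) show False
    by (simp add: algebra_simps)
qed

end


section \<open>Vanishing of the first asymptotic cohomology\<close>

locale asymptotic_group_module = asymptotic_banach_module \<Gamma> E \<pi> + group \<Gamma>
  for \<Gamma> :: "('g, 'm) monoid_scheme"
    and E :: "nat \<Rightarrow> ('k::real_normed_field, 'a) normed_module"
    and \<pi> :: "nat \<Rightarrow> 'g \<Rightarrow> 'a \<Rightarrow> 'a"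
begin

sublocale E: isometric_maps "E k" \<Gamma> "\<pi> k" for k
proof (intro isometric_maps.intro isometric_maps_axioms.intro banach group_axioms)
  show "\<pi> k g \<in> linear_isometries (E k)" if "g \<in> carrier \<Gamma>" for g
    using action[of k] that by (auto simp: hom_def Isom_def)
qed

abbreviation L :: "nat \<Rightarrow> nat \<Rightarrow> ('k, 'g list \<Rightarrow> 'a) normed_module" where
  "L n k \<equiv> ell_infty (tuples \<Gamma> n) (E k)"

abbreviation d :: "nat \<Rightarrow> nat \<Rightarrow> ('g list \<Rightarrow> 'a) \<Rightarrow> 'g list \<Rightarrow> 'a" where
  "d n k \<equiv> codifferential \<Gamma> (E k) (\<pi> k) n"

sublocale L: normed_group_sequence "L n" for n
  by (intro normed_group_sequence.intro E.normed_group_ell_infty E.tuples_nonempty)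

sublocale d: bounded_additive_sequence "L n" "L (Suc n)" "d (Suc n)" "real (n + 2)" for n
proof
  show "vnorm (L (Suc n) k) (d (Suc n) k f) \<le> real (n + 2) * vnorm (L n k) f"
    if "f \<in> carrier (L n k)" for f k
    by (rule vnorm_ell_infty_le[OF E.tuples_nonempty E.norm_codifferential_apply[OF that]])
qed (simp_all only: E.codifferential_closed E.codifferential_add of_nat_0_le_iff)

text \<open>For fixed \<open>t\<close>, the smallness condition of \<open>almost_fixed_point\<close>
  involves \<open>k\<close> only through \<open>\<eta> k + \<epsilon> k\<close>, so it holds for
  almost all \<open>k\<close> along \<open>\<U>\<close> and then for all group elements at
  once.\<close>

lemma almost_cocycle_near_coboundary:
  assumes \<U>: "\<U> \<le> sequentially" and "uniformly_convex E"
    and x: "x \<in> carrier (bounded_sequences (L 1))"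
    and cocycle: "(\<lambda>k. d 2 k (x k)) \<in> null_sequences \<U> (L 2)"
  obtains F where "F \<in> carrier (bounded_sequences (L 0))"
    and "x \<ominus>\<^bsub>bounded_sequences (L 1)\<^esub> (\<lambda>k. d 1 k (F k)) \<in> null_sequences \<U> (L 1)"
proof -
  obtain \<delta> :: "real \<Rightarrow> real" where \<delta>: "mono_on {0<..2} \<delta>" "\<delta> \<in> {0<..2} \<rightarrow> {0<..1}"
    and convex: "\<And>k \<epsilon> u v. \<epsilon> \<in> {0<..2} \<Longrightarrow> u \<in> carrier (E k) \<Longrightarrow> v \<in> carrier (E k) \<Longrightarrow>
      vnorm (E k) u \<le> 1 \<Longrightarrow> vnorm (E k) v \<le> 1 \<Longrightarrow> \<epsilon> \<le> vnorm (E k) (u \<ominus>\<^bsub>E k\<^esub> v) \<Longrightarrow>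
      vnorm (E k) ((1/2) \<odot>\<^bsub>E k\<^esub> (u \<oplus>\<^bsub>E k\<^esub> v)) \<le> 1 - \<delta> \<epsilon>"
    using \<open>uniformly_convex E\<close> unfolding uniformly_convex_def by metis
  obtain C where C: "0 \<le> C" "\<And>k. vnorm (L 1 k) (x k) \<le> C"
    using bounded_sequencesE[OF x] by metis
  define c where "c k g = x k [g]" for k g
  have xk: "x k \<in> carrier (L 1 k)" for k
    using x by (simp add: carrier_bounded_sequences_iff)
  have c: "c k g \<in> carrier (E k)" "vnorm (E k) (c k g) \<le> C" if "g \<in> carrier \<Gamma>" for k g
  proof -
    have g: "[g] \<in> tuples \<Gamma> 1"
      using that by (simp add: tuples_def)
    show "c k g \<in> carrier (E k)"
      unfolding c_def by (rule ell_infty_apply_closed[OF xk g])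
    show "vnorm (E k) (c k g) \<le> C"
      unfolding c_def using norm_le_vnorm_ell_infty[OF xk g] C(2) by (rule order_trans)
  qed
  \<comment> \<open>As a supremum norm, \<open>\<epsilon> k\<close> bounds the cocycle defect at all
    pairs of group elements simultaneously.\<close>
  define \<epsilon> where "\<epsilon> k = vnorm (L 2 k) (d 2 k (x k))" for k
  have d_carrier: "d 2 k (x k) \<in> carrier (L 2 k)" for k
    using cocycle by (simp add: null_sequences_def carrier_bounded_sequences_iff)
  have \<epsilon>_nonneg: "0 \<le> \<epsilon> k" for k
    unfolding \<epsilon>_def by (rule L.V.norm_nonneg[OF d_carrier])
  have \<epsilon>_lim: "(\<epsilon> \<longlongrightarrow> 0) \<U>"
    using cocycle unfolding null_sequences_def \<epsilon>_def by blast
  have cocycle_bound: "vnorm (E k) (\<pi> k g (c k h) \<ominus>\<^bsub>E k\<^esub> c k (g \<otimes>\<^bsub>\<Gamma>\<^esub> h) \<oplus>\<^bsub>E k\<^esub> c k g) \<le> \<epsilon> k"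
    if "g \<in> carrier \<Gamma>" "h \<in> carrier \<Gamma>" for k g h
  proof -
    have gh: "[g, h] \<in> tuples \<Gamma> 2"
      using that by (simp add: tuples_def)
    have "d 2 k (x k) [g, h] = \<pi> k g (c k h) \<ominus>\<^bsub>E k\<^esub> c k (g \<otimes>\<^bsub>\<Gamma>\<^esub> h) \<oplus>\<^bsub>E k\<^esub> c k g"
      using c(1) that unfolding c_def by (intro E.codifferential_2)
    then show ?thesis
      unfolding \<epsilon>_def using norm_le_vnorm_ell_infty[OF d_carrier gh] by metis
  qed
  \<comment> \<open>Any sequence of positive reals that is at most 1 and tends to 0 along
    \<open>\<U>\<close> would do.\<close>
  define \<eta> :: "nat \<Rightarrow> real" where "\<eta> k = inverse (Suc k)" for k
  have \<eta>_pos: "0 < \<eta> k" and \<eta>_le: "\<eta> k \<le> 1" for k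
    by (simp_all add: \<eta>_def field_simps)
  have \<eta>_lim: "(\<eta> \<longlongrightarrow> 0) \<U>"
    unfolding \<eta>_def using LIMSEQ_inverse_real_of_nat \<U> by (rule tendsto_mono[rotated])
  have "\<exists>v r. v \<in> carrier (E k) \<and> (\<forall>g\<in>carrier \<Gamma>. vnorm (E k) (c k g \<ominus>\<^bsub>E k\<^esub> v) \<le> r) \<and>
      (\<forall>w\<in>carrier (E k). \<exists>g\<in>carrier \<Gamma>. r - \<eta> k < vnorm (E k) (c k g \<ominus>\<^bsub>E k\<^esub> w))" for k
    by (rule E.approximate_center[of "carrier \<Gamma>" "c k" k C "\<eta> k"])
      (use c \<eta>_pos[of k] one_closed in blast)+
  then obtain v r where vr: "\<And>k. v k \<in> carrier (E k) \<and>
      (\<forall>g\<in>carrier \<Gamma>. vnorm (E k) (c k g \<ominus>\<^bsub>E k\<^esub> v k) \<le> r k) \<and>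
      (\<forall>w\<in>carrier (E k). \<exists>g\<in>carrier \<Gamma>. r k - \<eta> k < vnorm (E k) (c k g \<ominus>\<^bsub>E k\<^esub> w))"
    by metis
  have v: "v k \<in> carrier (E k)" for k
    using vr[of k] by blast
  have r: "vnorm (E k) (c k g \<ominus>\<^bsub>E k\<^esub> v k) \<le> r k" if "g \<in> carrier \<Gamma>" for k g
    using vr[of k] that by blast
  have center: "\<exists>g\<in>carrier \<Gamma>. r k - \<eta> k < vnorm (E k) (c k g \<ominus>\<^bsub>E k\<^esub> w)"
    if "w \<in> carrier (E k)" for k w
    using vr[of k] that by blast
  \<comment> \<open>The centres must be bounded in \<open>k\<close> to represent a class in degree
    0. Comparison with the competitor 0 gives \<open>r k \<le> C + 1\<close>, and \<open>v k\<close>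
    lies within \<open>r k\<close> of a value of norm at most \<open>C\<close>.\<close>
  have v_bound: "vnorm (E k) (v k) \<le> 2 * C + 1" for k
  proof -
    obtain g where g: "g \<in> carrier \<Gamma>" "r k - \<eta> k < vnorm (E k) (c k g \<ominus>\<^bsub>E k\<^esub> \<zero>\<^bsub>E k\<^esub>)"
      using center[OF E.zero_closed] by blast
    then have "r k \<le> C + 1"
      using E.norm_triangle_minus[OF c(1) E.zero_closed, of g k] c(2)[of g k] \<eta>_le[of k]
      by (simp add: E.norm_zero)
    moreover have "v k = c k g \<ominus>\<^bsub>E k\<^esub> (c k g \<ominus>\<^bsub>E k\<^esub> v k)"
      using c(1)[OF g(1)] v[of k] by (simp add: a_minus_def E.minus_add E.r_neg2)
    then have "vnorm (E k) (v k) \<le> vnorm (E k) (c k g) + vnorm (E k) (c k g \<ominus>\<^bsub>E k\<^esub> v k)"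
      using E.norm_triangle_minus[OF c(1)[OF g(1)] E.minus_closed[OF c(1)[OF g(1)] v[of k]]]
      by metis
    ultimately show ?thesis
      using c(2)[OF g(1), of k] r[OF g(1), of k] by linarith
  qed
  \<comment> \<open>The sign: if \<open>v\<close> is fixed by
    \<open>x \<mapsto> \<rho> g x \<oplus> c g\<close>, then
    \<open>c g = v \<ominus> \<rho> g v\<close>, which is the codifferential of
    \<open>\<ominus> v\<close> at \<open>g\<close>. In general the difference of the two is the
    displacement of \<open>v\<close>, as \<open>y_apply\<close> states.\<close>
  define F where "F k = (\<lambda>gs\<in>tuples \<Gamma> 0. \<ominus>\<^bsub>E k\<^esub> v k)" for k
  have F: "F \<in> carrier (bounded_sequences (L 0))"
  proof (rule bounded_sequencesI)
    show "F k \<in> carrier (L 0 k)" for k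
      by (rule ell_inftyI[where b = "2 * C + 1"]) (auto simp: F_def v v_bound E.norm_minus)
    show "vnorm (L 0 k) (F k) \<le> 2 * C + 1" for k
      by (rule vnorm_ell_infty_le[OF E.tuples_nonempty]) (auto simp: F_def v v_bound E.norm_minus)
  qed
  have dF: "(\<lambda>k. d 1 k (F k)) \<in> carrier (bounded_sequences (L 1))"
    using d.image_bounded[OF F] by simp
  let ?y = "x \<ominus>\<^bsub>bounded_sequences (L 1)\<^esub> (\<lambda>k. d 1 k (F k))"
  have y: "?y \<in> carrier (bounded_sequences (L 1))"
    using x dF by (rule L.bounded.minus_closed)
  have dFk: "d 1 k (F k) \<in> carrier (L 1 k)" for k
    using dF by (simp add: carrier_bounded_sequences_iff)
  have y_apply: "?y k [g] = \<pi> k g (v k) \<oplus>\<^bsub>E k\<^esub> c k g \<ominus>\<^bsub>E k\<^esub> v k" if "g \<in> carrier \<Gamma>" for k g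
  proof -
    have g: "[g] \<in> tuples \<Gamma> 1"
      using that by (simp add: tuples_def)
    have "?y k = x k \<oplus>\<^bsub>L 1 k\<^esub> (\<lambda>gs\<in>tuples \<Gamma> 1. \<ominus>\<^bsub>E k\<^esub> d 1 k (F k) gs)"
      by (simp only: a_minus_def L.uminus_bounded_sequences[OF dF] add_bounded_sequences
          E.uminus_ell_infty[OF dFk])
    then have "?y k [g] = c k g \<ominus>\<^bsub>E k\<^esub> d 1 k (F k) [g]"
      using g by (simp add: add_ell_infty c_def a_minus_def)
    also have "d 1 k (F k) [g] = \<pi> k g (\<ominus>\<^bsub>E k\<^esub> v k) \<ominus>\<^bsub>E k\<^esub> (\<ominus>\<^bsub>E k\<^esub> v k)"
      using that v[of k] E.codifferential_1[of "F k" k g] by (simp add: F_def tuples_0)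
    also have "c k g \<ominus>\<^bsub>E k\<^esub> (\<pi> k g (\<ominus>\<^bsub>E k\<^esub> v k) \<ominus>\<^bsub>E k\<^esub> (\<ominus>\<^bsub>E k\<^esub> v k))
        = \<pi> k g (v k) \<oplus>\<^bsub>E k\<^esub> c k g \<ominus>\<^bsub>E k\<^esub> v k"
      using that v[of k] c(1)[OF that, of k]
      by (simp add: a_minus_def E.minus_add E.map_uminus E.a_ac)
    finally show ?thesis .
  qed
  have "((\<lambda>k. vnorm (L 1 k) (?y k)) \<longlongrightarrow> 0) \<U>"
  proof (rule order_tendstoI)
    show "\<forall>\<^sub>F k in \<U>. a < vnorm (L 1 k) (?y k)" if "a < 0" for a
    proof (rule always_eventually, rule allI)
      fix k
      have "0 \<le> vnorm (L 1 k) (?y k)"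
        using y by (intro L.V.norm_nonneg) (simp add: carrier_bounded_sequences_iff)
      with that show "a < vnorm (L 1 k) (?y k)"
        by (rule less_le_trans)
    qed
  next
    fix a :: real assume "0 < a"
    \<comment> \<open>Pointwise bounds below \<open>t\<close> only give a supremum of at most
      \<open>t\<close>, so \<open>t\<close> is taken strictly below \<open>a\<close>. The other
      entry keeps \<open>t / (C + 1)\<close> in the domain of \<open>\<delta>\<close>.\<close>
    define t where "t = min (a / 2) (2 * (C + 1))"
    have t: "0 < t" "t < a" "t \<le> 2 * (C + 1)"
      using \<open>0 < a\<close> C(1) by (auto simp: t_def)
    have "t / (C + 1) \<in> {0<..2}"
      using t C(1) by (auto simp: field_simps)
    then have "0 < \<delta> (t / (C + 1))"
      using \<delta>(2) by auto
    then have "0 < min 1 (t / 2 * \<delta> (t / (C + 1)))"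
      using t by simp
    moreover have "((\<lambda>k. \<eta> k + \<epsilon> k) \<longlongrightarrow> 0) \<U>"
      by (rule tendsto_add_zero[OF \<eta>_lim \<epsilon>_lim])
    ultimately have "\<forall>\<^sub>F k in \<U>. \<eta> k + \<epsilon> k < min 1 (t / 2 * \<delta> (t / (C + 1)))"
      by (simp only: order_tendstoD(2))
    then show "\<forall>\<^sub>F k in \<U>. vnorm (L 1 k) (?y k) < a"
    proof eventually_elim
      fix k assume small: "\<eta> k + \<epsilon> k < min 1 (t / 2 * \<delta> (t / (C + 1)))"
      have "vnorm (L 1 k) (?y k) \<le> t"
      proof (rule vnorm_ell_infty_le[OF E.tuples_nonempty])
        fix gs assume "gs \<in> tuples \<Gamma> 1"
        then obtain g where g: "g \<in> carrier \<Gamma>" "gs = [g]"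
          unfolding tuples_1 by blast
        have "vnorm (E k) (\<pi> k g (v k) \<oplus>\<^bsub>E k\<^esub> c k g \<ominus>\<^bsub>E k\<^esub> v k) < t"
          using small
          by (intro E.almost_fixed_point[OF convex \<delta> c cocycle_bound v r center \<epsilon>_nonneg t(1,3)
                _ _ g(1)]) simp_all
        then show "vnorm (E k) (?y k gs) \<le> t"
          unfolding g(2) y_apply[OF g(1)] by (rule less_imp_le)
      qed
      with t(2) show "vnorm (L 1 k) (?y k) < a"
        by (rule order_le_less_trans[rotated])
    qed
  qed
  with y have "?y \<in> null_sequences \<U> (L 1)"
    unfolding null_sequences_def by blast
  with F show thesis
    by (rule that)
qed

section \<open>Cocycles and coboundaries in terms of representing sequences\<close>

lemma asymptotic_codifferential_ultraclass:
  assumes "x \<in> carrier (bounded_sequences (L n))"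
  shows "asymptotic_codifferential \<U> \<Gamma> E \<pi> (Suc n) (ultraclass \<U> (L n) x)
    = ultraclass \<U> (L (Suc n)) (\<lambda>k. d (Suc n) k (x k))"
  unfolding asymptotic_codifferential_def by (rule d.ultramap_ultraclass[OF assms])

lemma asymptotic_coboundaries_Suc:
  "asymptotic_coboundaries \<U> \<Gamma> E \<pi> (Suc n) =
    (\<lambda>x. ultraclass \<U> (L (Suc n)) (\<lambda>k. d (Suc n) k (x k))) ` carrier (bounded_sequences (L n))"
  by (simp add: asymptotic_coboundaries_def asymptotic_cochains_def L.carrier_ultraproduct
      image_image asymptotic_codifferential_ultraclass cong: image_cong)

text \<open>The zero of an ultraproduct is the subgroup of null sequences itself, and a coset equals
  the subgroup exactly if its representative lies in it. So lying in the kernel becomes a limit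
  along \<open>\<U>\<close>.\<close>

lemma asymptotic_cocycles_iff:
  "A \<in> asymptotic_cocycles \<U> \<Gamma> E \<pi> n \<longleftrightarrow>
    (\<exists>x\<in>carrier (bounded_sequences (L n)). A = ultraclass \<U> (L n) x \<and>
      (\<lambda>k. d (Suc n) k (x k)) \<in> null_sequences \<U> (L (Suc n)))"
proof -
  have class_eq: "ultraclass \<U> (L (Suc n)) (\<lambda>k. d (Suc n) k (x k)) = null_sequences \<U> (L (Suc n))
    \<longleftrightarrow> (\<lambda>k. d (Suc n) k (x k)) \<in> null_sequences \<U> (L (Suc n))"
    if x: "x \<in> carrier (bounded_sequences (L n))" for x
  proof
    assume "ultraclass \<U> (L (Suc n)) (\<lambda>k. d (Suc n) k (x k)) = null_sequences \<U> (L (Suc n))"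
    then show "(\<lambda>k. d (Suc n) k (x k)) \<in> null_sequences \<U> (L (Suc n))"
      using L.ultraclass_self[OF d.image_bounded[OF x]] by blast
  next
    assume "(\<lambda>k. d (Suc n) k (x k)) \<in> null_sequences \<U> (L (Suc n))"
    then show "ultraclass \<U> (L (Suc n)) (\<lambda>k. d (Suc n) k (x k)) = null_sequences \<U> (L (Suc n))"
      unfolding ultraclass_def by (rule L.null.a_rcos_const)
  qed
  have "A \<in> asymptotic_cocycles \<U> \<Gamma> E \<pi> n \<longleftrightarrow>
    (\<exists>x\<in>carrier (bounded_sequences (L n)). A = ultraclass \<U> (L n) x \<and>
      asymptotic_codifferential \<U> \<Gamma> E \<pi> (Suc n) (ultraclass \<U> (L n) x)
        = null_sequences \<U> (L (Suc n)))"
    unfolding asymptotic_cocycles_def a_kernel_def' asymptotic_cochains_def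
      L.carrier_ultraproduct Suc_eq_plus1[symmetric] L.zero_ultraproduct by blast
  also have "\<dots> \<longleftrightarrow> (\<exists>x\<in>carrier (bounded_sequences (L n)). A = ultraclass \<U> (L n) x \<and>
      (\<lambda>k. d (Suc n) k (x k)) \<in> null_sequences \<U> (L (Suc n)))"
    by (intro bex_cong refl conj_cong) (simp only: asymptotic_codifferential_ultraclass class_eq)
  finally show ?thesis .
qed

text \<open>Coboundaries are the image of the group of bounded sequences under an additive map.
  Translation by the image of \<open>x\<close> lifts to translation by \<open>x\<close> in that
  group, which is onto.\<close>

lemma translate_coboundaries:
  fixes \<U> :: "nat filter"
  assumes "x \<in> carrier (bounded_sequences (L n))"
  defines "B \<equiv> asymptotic_coboundaries \<U> \<Gamma> E \<pi> (Suc n)"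
  shows "(\<lambda>b. b \<oplus>\<^bsub>asymptotic_cochains \<U> \<Gamma> E (Suc n)\<^esub>
      ultraclass \<U> (L (Suc n)) (\<lambda>k. d (Suc n) k (x k))) ` B = B"
proof -
  let ?S = "bounded_sequences (L n)"
  let ?D = "\<lambda>x. ultraclass \<U> (L (Suc n)) (\<lambda>k. d (Suc n) k (x k))"
  have add: "?D y \<oplus>\<^bsub>asymptotic_cochains \<U> \<Gamma> E (Suc n)\<^esub> ?D x = ?D (y \<oplus>\<^bsub>?S\<^esub> x)"
    if "y \<in> carrier ?S" for y
  proof -
    have "(\<lambda>k. d (Suc n) k (y k)) \<oplus>\<^bsub>bounded_sequences (L (Suc n))\<^esub> (\<lambda>k. d (Suc n) k (x k))
        = (\<lambda>k. d (Suc n) k ((y \<oplus>\<^bsub>?S\<^esub> x) k))"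
      using that assms(1)
      by (simp add: add_bounded_sequences carrier_bounded_sequences_iff E.codifferential_add)
    then show ?thesis
      using L.add_ultraclass[OF d.image_bounded[OF that] d.image_bounded[OF assms(1)]]
      by (simp add: asymptotic_cochains_def)
  qed
  have shift: "(\<lambda>y. y \<oplus>\<^bsub>?S\<^esub> x) ` carrier ?S = carrier ?S"
  proof
    show "carrier ?S \<subseteq> (\<lambda>y. y \<oplus>\<^bsub>?S\<^esub> x) ` carrier ?S"
    proof
      fix y assume "y \<in> carrier ?S"
      then have "y = (y \<ominus>\<^bsub>?S\<^esub> x) \<oplus>\<^bsub>?S\<^esub> x" "y \<ominus>\<^bsub>?S\<^esub> x \<in> carrier ?S"
        using assms(1) by (simp_all add: a_minus_def L.bounded.a_assoc L.bounded.l_neg)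
      then show "y \<in> (\<lambda>y. y \<oplus>\<^bsub>?S\<^esub> x) ` carrier ?S"
        by (rule image_eqI)
    qed
  qed (use assms(1) in auto)
  have "(\<lambda>b. b \<oplus>\<^bsub>asymptotic_cochains \<U> \<Gamma> E (Suc n)\<^esub> ?D x) ` B
      = (\<lambda>y. ?D (y \<oplus>\<^bsub>?S\<^esub> x)) ` carrier ?S"
    unfolding B_def asymptotic_coboundaries_Suc image_image by (rule image_cong[OF refl add])
  also have "\<dots> = ?D ` (\<lambda>y. y \<oplus>\<^bsub>?S\<^esub> x) ` carrier ?S"
    by (simp only: image_image)
  also have "\<dots> = B"
    unfolding shift B_def asymptotic_coboundaries_Suc ..
  finally show ?thesis .
qed

text \<open>The elements of the quotient are the translates of the coboundaries by cocycles. If each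
  cocycle is a coboundary, all these translates coincide by
  \<open>translate_coboundaries\<close>.\<close>

lemma asymptotic_cohomology_trivial:
  assumes "asymptotic_cocycles \<U> \<Gamma> E \<pi> (Suc n) \<subseteq> asymptotic_coboundaries \<U> \<Gamma> E \<pi> (Suc n)"
  shows "carrier (asymptotic_cohomology \<U> \<Gamma> E \<pi> (Suc n))
    = {\<zero>\<^bsub>asymptotic_cohomology \<U> \<Gamma> E \<pi> (Suc n)\<^esub>}"
proof -
  let ?A = "asymptotic_cochains \<U> \<Gamma> E (Suc n)"
  let ?Z = "asymptotic_cocycles \<U> \<Gamma> E \<pi> (Suc n)"
  let ?B = "asymptotic_coboundaries \<U> \<Gamma> E \<pi> (Suc n)"
  have coset: "(\<Union>b\<in>?B. {b \<oplus>\<^bsub>?A\<^esub> z}) = ?B" if z: "z \<in> ?Z" for z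
  proof -
    have "z \<in> ?B"
      using assms z by blast
    then obtain x where x: "x \<in> carrier (bounded_sequences (L n))"
      and z_eq: "z = ultraclass \<U> (L (Suc n)) (\<lambda>k. d (Suc n) k (x k))"
      unfolding asymptotic_coboundaries_Suc by blast
    show ?thesis
      unfolding z_eq UNION_singleton_eq_range by (rule translate_coboundaries[OF x])
  qed
  \<comment> \<open>The class of 0 is a cocycle. Without any cocycle the carrier of the quotient
    would be empty rather than a singleton.\<close>
  have "(\<lambda>k. d (Suc (Suc n)) k (\<zero>\<^bsub>L (Suc n) k\<^esub>)) \<in> null_sequences \<U> (L (Suc (Suc n)))"
    using d.image_null[OF L.null.zero_closed] by (simp add: zero_bounded_sequences)
  then have "ultraclass \<U> (L (Suc n)) \<zero>\<^bsub>bounded_sequences (L (Suc n))\<^esub> \<in> ?Z"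
    unfolding asymptotic_cocycles_iff
    by (intro bexI[OF _ L.bounded.zero_closed]) (simp add: zero_bounded_sequences)
  then have "?Z \<noteq> {}" by blast
  have "carrier (asymptotic_cohomology \<U> \<Gamma> E \<pi> (Suc n)) = (\<Union>z\<in>?Z. {\<Union>b\<in>?B. {b \<oplus>\<^bsub>?A\<^esub> z}})"
    by (simp add: asymptotic_cohomology_def quotient_space_def A_RCOSETS_def' a_r_coset_def')
  also have "\<dots> = (\<Union>z\<in>?Z. {?B})"
    by (rule SUP_cong[OF refl]) (simp only: coset)
  also have "\<dots> = {?B}"
    using \<open>?Z \<noteq> {}\<close> by simp
  finally show ?thesis
    by (simp add: asymptotic_cohomology_def quotient_space_def)
qed

lemma cocycles_subset_coboundaries:
  assumes "\<U> \<le> sequentially" "uniformly_convex E"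
  shows "asymptotic_cocycles \<U> \<Gamma> E \<pi> (Suc 0) \<subseteq> asymptotic_coboundaries \<U> \<Gamma> E \<pi> (Suc 0)"
proof
  fix A assume "A \<in> asymptotic_cocycles \<U> \<Gamma> E \<pi> (Suc 0)"
  then obtain x where x: "x \<in> carrier (bounded_sequences (L 1))" "A = ultraclass \<U> (L 1) x"
    and cocycle: "(\<lambda>k. d 2 k (x k)) \<in> null_sequences \<U> (L 2)"
    unfolding asymptotic_cocycles_iff by (auto simp: numeral_2_eq_2)
  obtain F where F: "F \<in> carrier (bounded_sequences (L 0))"
    and near: "x \<ominus>\<^bsub>bounded_sequences (L 1)\<^esub> (\<lambda>k. d 1 k (F k)) \<in> null_sequences \<U> (L 1)"
    using almost_cocycle_near_coboundary[OF assms x(1) cocycle] .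
  have "(\<lambda>k. d 1 k (F k)) \<in> carrier (bounded_sequences (L 1))"
    using d.image_bounded[OF F] by simp
  then have "A = ultraclass \<U> (L 1) (\<lambda>k. d 1 k (F k))"
    unfolding x(2) using x(1) near by (intro L.ultraclass_eqI)
  with F show "A \<in> asymptotic_coboundaries \<U> \<Gamma> E \<pi> (Suc 0)"
    unfolding asymptotic_coboundaries_Suc by simp
qed

end

theorem theoremC:
  fixes \<U> :: "nat filter"
    and \<Gamma> :: "('g, 'm) monoid_scheme"
    and E :: "nat \<Rightarrow> ('k::real_normed_field, 'a) normed_module"
    and \<pi> :: "nat \<Rightarrow> 'g \<Rightarrow> 'a \<Rightarrow> 'a"
  assumes "nonprincipal_ultrafilter \<U>"
    and "group \<Gamma>"
    and "asymptotic_banach_module \<Gamma> E \<pi>"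
    and "uniformly_convex E"
  shows "carrier (asymptotic_cohomology \<U> \<Gamma> E \<pi> 1) = {\<zero>\<^bsub>asymptotic_cohomology \<U> \<Gamma> E \<pi> 1\<^esub>}"
proof -
  interpret asymptotic_group_module \<Gamma> E \<pi>
    using assms(3,2) by (rule asymptotic_group_module.intro)
  have "\<U> \<le> sequentially"
    using assms(1) by (rule nonprincipal_ultrafilter_le_sequentially)
  then show ?thesis
    using asymptotic_cohomology_trivial[OF cocycles_subset_coboundaries] assms(4) by simp
qed

end
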